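(* Let $m\ge 1$ be an integer, $q_1,\dots,q_m\in\mathbb{R}$, $\tilde\varepsilon,\tilde\alpha\in\mathbb{R}$, let $\mathcal{G}=\prod_{j=1}^m(\Delta+q_j^2)$ act on functions on $\mathbb{R}^d$ ($d\in\{1,2,3\}$), and let $\mathcal{N}(\phi)=\frac{\tilde\varepsilon}{2}\phi^2-\frac{\tilde\alpha}{3}\phi^3+\frac14\phi^4$. Suppose that $F_1(\phi):=\langle\mathcal{N}(\phi),1\rangle_{AP}+C_1\ge 0$, where $C_1$ is a positive constant. Let $0=t^0<t^1<\dots<t^{N_T}=T$ be a partition of $[0,T]$ with step sizes $\tau^n=t^{n+1}-t^n$. Consider the SAV/CN scheme: for $n\ge 1$, given $\phi^n,\mathcal{R}^n$ and $\phi^{n-1},\mathcal{R}^{n-1}$ (where the $\phi^n$ are functions on $\mathbb{R}^d$ and the $\mathcal{R}^n$ are real numbers), $\phi^{n+1}$ and $\mathcal{R}^{n+1}$ are determined by $$\frac{\phi^{n+1}-\phi^n}{\tau^n}=-\mathcal{W}^{n+1/2},$$ $$\mathcal{W}^{n+1/2}=\mathcal{G}^2\phi^{n+1/2}+\frac{\mathcal{R}^{n+1/2}}{\sqrt{F_1(\bar\phi^{n+1/2})}}\,\mathcal{N}'(\bar\phi^{n+1/2}),$$ $$\frac{\mathcal{R}^{n+1}-\mathcal{R}^n}{\tau^n}=\left\langle\frac{\mathcal{N}'(\bar\phi^{n+1/2})}{2\sqrt{F_1(\bar\phi^{n+1/2})}},\frac{\phi^{n+1}-\phi^n}{\tau^n}\right\rangle_{AP},$$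 where $\mathcal{R}^{n+1/2}=(\mathcal{R}^{n+1}+\mathcal{R}^n)/2$, $\phi^{n+1/2}=(\phi^{n+1}+\phi^n)/2$ and $\bar\phi^{n+1/2}=(3\phi^n-\phi^{n-1})/2$. Define $$\mathcal{F}^n_{SAV/CN}=\frac12\|\mathcal{G}\phi^n\|_{AP}^2+(\mathcal{R}^n)^2-C_1 .$$ Then the SAV/CN scheme satisfies the energy dissipation law $$\mathcal{F}^{n+1}_{SAV/CN}-\mathcal{F}^n_{SAV/CN}\le 0 .$$
   Context: The setting is that of real-valued almost periodic functions. A function $f$ on $\mathbb{R}^d$ is almost periodic if it is continuous and for every $\epsilon>0$ there is $L=L(\epsilon,f)$ such that every cube of side length $L$ in $\mathbb{R}^d$ contains a point $\zeta$ with $|f(\mathbf r-\zeta)-f(\mathbf r)|<\epsilon$ for all $\mathbf r\in\mathbb{R}^d$. The almost periodic inner product is $$\langle f,g\rangle_{AP}=\lim_{R\to\infty}\frac{1}{|Q(R)|}\int_{Q(R)}f(\mathbf r)\overline{g(\mathbf r)}\,d\mathbf r,\qquad Q(R)=[-R,R]^d,$$ and $\|f\|_{AP}^2=\langle f,f\rangle_{AP}$. $\Delta$ is the Laplacian on $\mathbb{R}^d$, and $\mathcal{N}'(\phi)=\tilde\varepsilon\phi-\tilde\alpha\phi^2+\phi^3$. The superscript $n$ on $\phi^n,\mathcal{R}^n,\tau^n,t^n$ is an index, while $(\mathcal{R}^n)^2$ is the square of $\mathcal{R}^n$. *)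

theory Defs
  imports "HOL-Analysis.Analysis"
begin

definition almost_periodic :: "(real ^ 'd \<Rightarrow> real) \<Rightarrow> bool" where
  "almost_periodic f \<longleftrightarrow>
     continuous_on UNIV f \<and>
     (\<forall>\<epsilon>>0. \<exists>L>0. \<forall>a. \<exists>\<zeta> \<in> cbox a (\<chi> i. a $ i + L). \<forall>r. \<bar>f (r - \<zeta>) - f r\<bar> < \<epsilon>)"

definition cube :: "real \<Rightarrow> (real ^ 'd) set" where
  "cube \<rho> = cbox (\<chi> i. - \<rho>) (\<chi> i. \<rho>)"

text \<open>All functions are real-valued, so the conjugate in the inner product is omitted.\<close>

definition ap_inner :: "(real ^ 'd \<Rightarrow> real) \<Rightarrow> (real ^ 'd \<Rightarrow> real) \<Rightarrow> real" where
  "ap_inner f g =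
     Lim at_top (\<lambda>\<rho>. 1 / measure lebesgue (cube \<rho> :: (real ^ 'd) set) *
                      integral (cube \<rho>) (\<lambda>r. f r * g r))"

definition ap_norm :: "(real ^ 'd \<Rightarrow> real) \<Rightarrow> real" where
  "ap_norm f = sqrt (ap_inner f f)"

definition partial_derivative :: "'d \<Rightarrow> (real ^ 'd \<Rightarrow> real) \<Rightarrow> real ^ 'd \<Rightarrow> real" where
  "partial_derivative i f r = deriv (\<lambda>t. f (r + t *\<^sub>R axis i 1)) 0"

text \<open>\<open>C_class k f\<close>: all iterated partial derivatives of \<open>f\<close> of order at most \<open>k\<close> exist
  everywhere and are continuous. The existence clause is needed because \<^const>\<open>deriv\<close> is total.\<close>

primrec C_class :: "nat \<Rightarrow> (real ^ 'd \<Rightarrow> real) \<Rightarrow> bool" where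
  "C_class 0 f \<longleftrightarrow> continuous_on UNIV f"
| "C_class (Suc k) f \<longleftrightarrow>
     continuous_on UNIV f \<and>
     (\<forall>i. (\<forall>r. (\<lambda>t. f (r + t *\<^sub>R axis i 1)) field_differentiable (at 0)) \<and>
          C_class k (partial_derivative i f))"

definition laplacian :: "(real ^ 'd \<Rightarrow> real) \<Rightarrow> real ^ 'd \<Rightarrow> real" where
  "laplacian f r = (\<Sum>i\<in>UNIV. partial_derivative i (partial_derivative i f) r)"

text \<open>\<open>G_op q m\<close> is the composition of the operators \<open>\<Delta> + (q j)\<^sup>2\<close> for \<open>j = 1, \<dots>, m\<close>.\<close>

primrec G_op :: "(nat \<Rightarrow> real) \<Rightarrow> nat \<Rightarrow> (real ^ 'd \<Rightarrow> real) \<Rightarrow> real ^ 'd \<Rightarrow> real" where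
  "G_op q 0 f = f"
| "G_op q (Suc m) f =
     (\<lambda>r. laplacian (G_op q m f) r + (q (Suc m))\<^sup>2 * G_op q m f r)"

definition N_pot :: "real \<Rightarrow> real \<Rightarrow> real \<Rightarrow> real" where
  "N_pot \<epsilon> \<alpha> s = \<epsilon> / 2 * s\<^sup>2 - \<alpha> / 3 * s ^ 3 + 1 / 4 * s ^ 4"

definition N_pot' :: "real \<Rightarrow> real \<Rightarrow> real \<Rightarrow> real" where
  "N_pot' \<epsilon> \<alpha> s = \<epsilon> * s - \<alpha> * s\<^sup>2 + s ^ 3"

definition F1 :: "real \<Rightarrow> real \<Rightarrow> real \<Rightarrow> (real ^ 'd \<Rightarrow> real) \<Rightarrow> real" where
  "F1 \<epsilon> \<alpha> C\<^sub>1 \<phi> = ap_inner (\<lambda>r. N_pot \<epsilon> \<alpha> (\<phi> r)) (\<lambda>r. 1) + C\<^sub>1"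

text \<open>The values at \<open>n + 1/2\<close> are indexed by \<open>n\<close>.\<close>

definition half_fun :: "(nat \<Rightarrow> real ^ 'd \<Rightarrow> real) \<Rightarrow> nat \<Rightarrow> real ^ 'd \<Rightarrow> real" where
  "half_fun \<phi> n r = (\<phi> (n + 1) r + \<phi> n r) / 2"

definition half_scalar :: "(nat \<Rightarrow> real) \<Rightarrow> nat \<Rightarrow> real" where
  "half_scalar R n = (R (n + 1) + R n) / 2"

text \<open>Only used for \<open>n \<ge> 1\<close>, as \<open>n - 1\<close> is truncated subtraction.\<close>

definition extrap_fun :: "(nat \<Rightarrow> real ^ 'd \<Rightarrow> real) \<Rightarrow> nat \<Rightarrow> real ^ 'd \<Rightarrow> real" where
  "extrap_fun \<phi> n r = (3 * \<phi> n r - \<phi> (n - 1) r) / 2"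

definition SAV_energy ::
  "(nat \<Rightarrow> real) \<Rightarrow> nat \<Rightarrow> real \<Rightarrow> (nat \<Rightarrow> real ^ 'd \<Rightarrow> real) \<Rightarrow> (nat \<Rightarrow> real) \<Rightarrow> nat \<Rightarrow> real" where
  "SAV_energy q m C\<^sub>1 \<phi> R n = 1 / 2 * (ap_norm (G_op q m (\<phi> n)))\<^sup>2 + (R n)\<^sup>2 - C\<^sub>1"

end

theory Submission
  imports Defs
begin

text \<open>Testing the equation for \<open>\<phi>\<close> with \<open>\<phi>\<^sup>n\<^sup>+\<^sup>1 - \<phi>\<^sup>n\<close> and the one for \<open>R\<close> with \<open>R\<^sup>n\<^sup>+\<^sup>1 + R\<^sup>n\<close>, the nonlinear
  terms cancel and the energy changes by \<open>- \<parallel>\<phi>\<^sup>n\<^sup>+\<^sup>1 - \<phi>\<^sup>n\<parallel>\<^sup>2 / \<tau>\<^sup>n\<close>, provided that the mean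
  values exist and \<open>G\<close> is symmetric. Means of products exist because translates of almost periodic
  functions are totally bounded. Symmetry is delicate, since the intermediate derivatives need not
  be bounded. Averaging twice over a segment of length \<open>h\<close> in a coordinate direction turns the
  second derivative in that direction into a second difference quotient. Hence a suitable local
  average of \<open>G f\<close> is obtained from \<open>f\<close> by finite differences and averages only, an operator that is symmetric by
  translation invariance of the mean. Finally \<open>h\<close> tends to \<open>0\<close>.\<close>

section \<open>Means of almost periodic functions\<close>

text \<open>Integrating by parts over a cube would leave boundary terms with derivatives of
  intermediate order, whose growth is unknown: only \<open>\<phi> n\<close> and
  \<open>G_op q m (\<phi> n)\<close> are assumed almost periodic. The operators that replace
  differentiation are convolutions with compactly supported signed measures. They therefore preserve
  bounded continuous functions and commute with each other. Commutation is used twice: it moves the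
  averages belonging to the m factors outside of G, and it makes a product of symmetric operators
  symmetric. The order of the limits matters. Bounds for the finite differences may blow up as h
  tends to 0, but h is fixed while the cube grows, so this is harmless; h enters the final error
  only through the distance between G f and its local average, which uniform continuity makes small
  independently of the cube. In the energy estimate symmetry is applied to the increment and to G of
  the midpoint. That \<open>G_op q m (G_op q m w)\<close> has means at all is read off from the
  scheme, which writes it as a combination of almost periodic functions.\<close>

definition cube_mean :: "real \<Rightarrow> (real ^ 'd \<Rightarrow> real) \<Rightarrow> real" where
  "cube_mean \<rho> f = 1 / measure lebesgue (cube \<rho> :: (real ^ 'd) set) * integral (cube \<rho>) f"

lemma continuous_on_comp_UNIV:
  assumes "continuous_on UNIV f" "continuous_on S g"
  shows "continuous_on S (\<lambda>x. f (g x))"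
  using assms continuous_on_compose2[of UNIV f S g] by simp

lemma measure_cube:
  assumes "\<rho> \<ge> 0"
  shows "measure lebesgue (cube \<rho> :: (real ^ 'd) set) = (2 * \<rho>) ^ CARD('d)"
proof -
  have "(\<chi> i. 0) \<in> (cube \<rho> :: (real ^ 'd) set)"
    using assms by (simp add: cube_def mem_box_cart)
  then have "cbox (\<chi> i. - \<rho>) (\<chi> i. \<rho>) \<noteq> ({} :: (real ^ 'd) set)"
    by (auto simp: cube_def)
  from content_cbox_cart[OF this] show ?thesis
    by (simp add: cube_def)
qed

lemma continuous_integrable_cube:
  "continuous_on UNIV f \<Longrightarrow> f integrable_on (cube \<rho>)" for f :: "real ^ 'd \<Rightarrow> real"
  unfolding cube_def by (intro integrable_continuous continuous_on_subset[where s = UNIV and t = "cbox _ _"]) auto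

lemma cube_mean_add:
  assumes "continuous_on UNIV f" "continuous_on UNIV g"
  shows "cube_mean \<rho> (\<lambda>x. f x + g x) = cube_mean \<rho> f + cube_mean \<rho> g"
  unfolding cube_mean_def
  by (subst integral_add) (auto intro: continuous_integrable_cube assms simp: algebra_simps add_divide_distrib)

lemma cube_mean_cmul: "cube_mean \<rho> (\<lambda>x. c * f x) = c * cube_mean \<rho> f"
  unfolding cube_mean_def by (simp add: integral_mult_right)

lemma cube_mean_diff:
  assumes "continuous_on UNIV f" "continuous_on UNIV g"
  shows "cube_mean \<rho> (\<lambda>x. f x - g x) = cube_mean \<rho> f - cube_mean \<rho> g"
  unfolding cube_mean_def
  by (subst integral_diff) (auto intro: continuous_integrable_cube assms simp: algebra_simps diff_divide_distrib)

lemma cube_mean_const: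
  assumes "\<rho> > 0"
  shows "cube_mean \<rho> (\<lambda>x :: real ^ 'd. c) = c"
proof -
  have "integral (cube \<rho>) (\<lambda>x :: real ^ 'd. c) = measure lebesgue (cube \<rho> :: (real ^ 'd) set) * c"
    by (simp add: cube_def)
  moreover have "measure lebesgue (cube \<rho> :: (real ^ 'd) set) \<noteq> 0"
    using assms by (simp add: measure_cube)
  ultimately show ?thesis by (simp add: cube_mean_def)
qed

lemma cube_mean_mono:
  assumes "continuous_on UNIV f" "continuous_on UNIV g" "\<And>x. f x \<le> g x"
  shows "cube_mean \<rho> f \<le> cube_mean \<rho> g"
  unfolding cube_mean_def
  by (intro mult_left_mono integral_le continuous_integrable_cube assms) auto

lemma cube_mean_bound:
  fixes f :: "real ^ 'd \<Rightarrow> real"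
  assumes "continuous_on UNIV f" "\<And>x. \<bar>f x\<bar> \<le> B" "\<rho> > 0"
  shows "\<bar>cube_mean \<rho> f\<bar> \<le> B"
proof -
  have "f x \<le> B" "- B \<le> f x" for x using assms(2)[of x] by auto
  then have "cube_mean \<rho> f \<le> cube_mean \<rho> (\<lambda>x :: real ^ 'd. B) \<and>
      cube_mean \<rho> (\<lambda>x :: real ^ 'd. - B) \<le> cube_mean \<rho> f"
    by (intro conjI cube_mean_mono assms(1) continuous_on_const)
  then show ?thesis unfolding cube_mean_const[OF assms(3)] by (simp add: abs_le_iff)
qed

section \<open>Translation invariance of the mean, with an explicit error\<close>

lemma integral_diff_subbox:
  fixes F :: "real ^ 'd \<Rightarrow> real"
  assumes F: "continuous_on UNIV F" "\<And>x. \<bar>F x\<bar> \<le> B"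
    and sub: "cbox c d \<subseteq> cbox a b"
  shows "\<bar>integral (cbox a b) F - integral (cbox c d) F\<bar> \<le>
    B * (measure lebesgue (cbox a b) - measure lebesgue (cbox c d))"
proof -
  have i: "F integrable_on cbox x y" for x y
    by (intro integrable_continuous continuous_on_subset[OF F(1)]) auto
  have neg: "negligible (cbox c d - cbox a b)" using sub by simp
  have "norm (integral (cbox a b - cbox c d) F) \<le> integral (cbox a b - cbox c d) (\<lambda>x. B)"
    by (rule integral_norm_bound_integral)
       (use F(2) in \<open>auto intro!: integrable_setdiff i neg integrable_const\<close>)
  moreover have "integral (cbox a b - cbox c d) F = integral (cbox a b) F - integral (cbox c d) F"
    by (intro integral_setdiff i neg)
  moreover have "integral (cbox a b - cbox c d) (\<lambda>x. B) =
      integral (cbox a b) (\<lambda>x. B) - integral (cbox c d) (\<lambda>x. B)"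
    by (intro integral_setdiff neg integrable_const)
  ultimately show ?thesis by (simp add: algebra_simps)
qed

text \<open>The cube and its translate by \<open>v\<close> both contain the cube of half side length \<open>\<rho> - s\<close>.\<close>

lemma cube_mean_shift:
  fixes F :: "real ^ 'd \<Rightarrow> real"
  assumes F: "continuous_on UNIV F" "\<And>x. \<bar>F x\<bar> \<le> B"
    and v: "norm v \<le> s" and s: "s < \<rho>"
  shows "\<bar>cube_mean \<rho> (\<lambda>x. F (x + v)) - cube_mean \<rho> F\<bar> \<le> 2 * B * (1 - (1 - s / \<rho>) ^ CARD('d))"
proof -
  have s0: "0 \<le> s" "0 < \<rho>" using v s norm_ge_zero[of v] by linarith+
  define b :: "real ^ 'd" where "b = (\<chi> i. \<rho>)"
  define a :: "real ^ 'd" where "a = (\<chi> i. - \<rho>)"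
  define m where "m = measure lebesgue (cube \<rho> :: (real ^ 'd) set)"
  define m' where "m' = measure lebesgue (cube (\<rho> - s) :: (real ^ 'd) set)"
  have m: "m = (2 * \<rho>) ^ CARD('d)" "m' = (2 * (\<rho> - s)) ^ CARD('d)"
    unfolding m_def m'_def using s s0 by (auto simp: measure_cube)
  have mpos: "m > 0" using m s0 by simp
  have vi: "\<bar>v $ i\<bar> \<le> s" for i using component_le_norm_cart[of v i] v by linarith
  have sub1: "(cube (\<rho> - s) :: (real ^ 'd) set) \<subseteq> cbox (a + v) (b + v)"
  proof
    fix x :: "real ^ 'd" assume "x \<in> cube (\<rho> - s)"
    then have "- (\<rho> - s) \<le> x $ i \<and> x $ i \<le> \<rho> - s" for i by (simp add: cube_def mem_box_cart)
    then show "x \<in> cbox (a + v) (b + v)"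
      unfolding mem_box_cart a_def b_def using vi by (auto simp: abs_le_iff) (smt (verit))+
  qed
  have sub2: "(cube (\<rho> - s) :: (real ^ 'd) set) \<subseteq> cbox a b"
    unfolding cube_def a_def b_def using s0 by (auto simp: mem_box_cart) (smt (verit))+
  have meas: "measure lebesgue (cbox (a + v) (b + v)) = m"
    using content_cbox_if_cart[of "a + v" "b + v"] content_cbox_if_cart[of a b] s0 m
    by (auto simp: m_def cube_def a_def b_def interval_eq_empty_cart)
  have "integral (cube \<rho>) (\<lambda>x. F (x + v)) = integral (cbox (a + v) (b + v)) F"
    using integral_shift_cbox[of "a + v" v "b + v" F] by (simp add: cube_def a_def b_def)
  moreover have "\<bar>integral (cbox (a + v) (b + v)) F - integral (cube (\<rho> - s)) F\<bar> \<le> B * (m - m')"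
    using integral_diff_subbox[OF F, of _ _ "a + v" "b + v"] sub1 meas
    by (simp add: cube_def m'_def)
  moreover have "\<bar>integral (cube \<rho>) F - integral (cube (\<rho> - s)) F\<bar> \<le> B * (m - m')"
    using integral_diff_subbox[OF F, of _ _ a b] sub2
    by (simp add: cube_def m'_def m_def a_def b_def)
  ultimately have "\<bar>integral (cube \<rho>) (\<lambda>x. F (x + v)) - integral (cube \<rho>) F\<bar> \<le> 2 * B * (m - m')"
    by linarith
  then have "\<bar>integral (cube \<rho>) (\<lambda>x. F (x + v)) - integral (cube \<rho>) F\<bar> / m \<le> 2 * B * (m - m') / m"
    using mpos by (simp add: divide_right_mono)
  moreover have "\<bar>integral (cube \<rho>) (\<lambda>x. F (x + v)) - integral (cube \<rho>) F\<bar> / m =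
      \<bar>cube_mean \<rho> (\<lambda>x. F (x + v)) - cube_mean \<rho> F\<bar>"
    using mpos unfolding cube_mean_def m_def[symmetric]
    by (simp add: diff_divide_distrib[symmetric] abs_divide)
  moreover have "2 * B * (m - m') / m = 2 * B * (1 - (1 - s / \<rho>) ^ CARD('d))"
  proof -
    have "m' / m = (1 - s / \<rho>) ^ CARD('d)"
      unfolding m power_divide[symmetric] using s0
      by (intro arg_cong[where f = "\<lambda>x. x ^ CARD('d)"]) (simp add: field_simps)
    then show ?thesis using mpos by (simp add: field_simps)
  qed
  ultimately show ?thesis by simp
qed

lemma shift_error_tendsto_0:
  "((\<lambda>\<rho>. 2 * B * (1 - (1 - s / \<rho>) ^ n)) \<longlongrightarrow> 0) at_top" for B s :: real
proof -
  have "((\<lambda>\<rho>. s / \<rho>) \<longlongrightarrow> 0) at_top"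
    by (intro tendsto_divide_0[OF tendsto_const] filterlim_at_top_imp_at_infinity filterlim_ident)
  then have "((\<lambda>\<rho>. 2 * B * (1 - (1 - s / \<rho>) ^ n)) \<longlongrightarrow> 2 * B * (1 - (1 - 0) ^ n)) at_top"
    by (intro tendsto_intros)
  then show ?thesis by simp
qed

section \<open>Total boundedness of translates\<close>

text \<open>Bochner's form of almost periodicity: the translates of \<open>f\<close> are totally bounded in the
  supremum norm. Unlike Bohr's form it is readily seen to be preserved by sums and products.\<close>

definition bochner_ap :: "(real ^ 'd \<Rightarrow> real) \<Rightarrow> bool" where
  "bochner_ap f \<longleftrightarrow> continuous_on UNIV f \<and>
     (\<forall>e>0. \<exists>Y. finite Y \<and> (\<forall>y. \<exists>y'\<in>Y. \<forall>x. \<bar>f (x + y) - f (x + y')\<bar> \<le> e))"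

lemma bochner_ap_continuous: "bochner_ap f \<Longrightarrow> continuous_on UNIV f"
  by (simp add: bochner_ap_def)

lemma bochner_ap_bounded:
  assumes "bochner_ap f"
  obtains B where "B > 0" "\<And>x. \<bar>f x\<bar> \<le> B"
proof -
  obtain Y where Y: "finite Y" "\<And>y. \<exists>y'\<in>Y. \<forall>x. \<bar>f (x + y) - f (x + y')\<bar> \<le> 1"
    using assms unfolding bochner_ap_def by (meson zero_less_one)
  show ?thesis
  proof (rule that[of "1 + (\<Sum>y\<in>Y. \<bar>f y\<bar>)"])
    show "1 + (\<Sum>y\<in>Y. \<bar>f y\<bar>) > 0" by (smt (verit) sum_nonneg abs_ge_zero)
    fix x
    from Y(2)[of x] obtain y' where y': "y' \<in> Y" "\<bar>f (0 + x) - f (0 + y')\<bar> \<le> 1" by blast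
    have "\<bar>f y'\<bar> \<le> (\<Sum>y\<in>Y. \<bar>f y\<bar>)"
      using y'(1) Y(1) by (intro member_le_sum) auto
    then show "\<bar>f x\<bar> \<le> 1 + (\<Sum>y\<in>Y. \<bar>f y\<bar>)" using y'(2) by simp
  qed
qed

text \<open>Continuity at the finitely many net points suffices: the translate by \<open>x\<close>
  is compared with that by a net point \<open>y'\<close> once at \<open>z\<close> and once at
  \<open>0\<close>, which together with continuity at \<open>y'\<close> makes three errors of
  \<open>e / 3\<close>. The lemma is what makes averages over small sets uniformly close to the
  function.\<close>

lemma bochner_ap_uniformly_continuous:
  fixes f :: "real ^ 'd \<Rightarrow> real"
  assumes "bochner_ap f" "e > 0"
  obtains r where "r > 0" "\<And>x z. norm z \<le> r \<Longrightarrow> \<bar>f (x + z) - f x\<bar> \<le> e"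
proof -
  obtain Y where Y: "finite Y" "\<And>y. \<exists>y'\<in>Y. \<forall>x. \<bar>f (x + y) - f (x + y')\<bar> \<le> e / 3"
    using assms unfolding bochner_ap_def by (meson divide_pos_pos zero_less_numeral)
  have c: "isCont f y" for y
    using bochner_ap_continuous[OF assms(1)] by (simp add: continuous_on_eq_continuous_at)
  have "\<forall>\<^sub>F z in at 0. \<bar>f (y + z) - f y\<bar> < e / 3" for y
  proof -
    have "((\<lambda>z. f (y + z)) \<longlongrightarrow> f y) (at 0)"
      using c[of y] by (simp add: isCont_def LIM_offset_zero_iff)
    then show ?thesis using tendstoD[of _ "f y" "at 0" "e / 3"] assms(2) by (simp add: dist_real_def)
  qed
  then have "\<forall>\<^sub>F z in at 0. \<forall>y\<in>Y. \<bar>f (y + z) - f y\<bar> < e / 3"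
    using Y(1) by (simp add: eventually_ball_finite)
  then obtain d where d: "d > 0" "\<And>z. z \<noteq> 0 \<Longrightarrow> dist z 0 < d \<Longrightarrow> \<forall>y\<in>Y. \<bar>f (y + z) - f y\<bar> < e / 3"
    unfolding eventually_at by auto
  show ?thesis
  proof (rule that[of "d / 2"])
    show "d / 2 > 0" using d by simp
    fix x z :: "real ^ 'd" assume z: "norm z \<le> d / 2"
    from Y(2)[of x] obtain y' where y': "y' \<in> Y" "\<And>w. \<bar>f (w + x) - f (w + y')\<bar> \<le> e / 3" by blast
    have "\<bar>f (y' + z) - f y'\<bar> \<le> e / 3"
    proof (cases "z = 0")
      case False
      then show ?thesis using d(2)[of z] d(1) z y'(1) by force
    qed (use assms in simp)
    then show "\<bar>f (x + z) - f x\<bar> \<le> e"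
      using y'(2)[of z] y'(2)[of 0] unfolding add.commute[of z] add_0 by argo
  qed
qed

text \<open>A common net for two functions is obtained by choosing one translation vector for each
  pair of net elements that some vector is close to.\<close>

lemma bochner_ap_common_net:
  assumes "bochner_ap f" "bochner_ap g" "e > 0"
  obtains Y where "finite Y"
    "\<And>y. \<exists>y'\<in>Y. \<forall>x. \<bar>f (x + y) - f (x + y')\<bar> \<le> e \<and> \<bar>g (x + y) - g (x + y')\<bar> \<le> e"
proof -
  have e2: "e / 2 > 0" using assms by simp
  obtain Y where Y: "finite Y" "\<And>y. \<exists>y'\<in>Y. \<forall>x. \<bar>f (x + y) - f (x + y')\<bar> \<le> e / 2"
    using assms(1) e2 unfolding bochner_ap_def by meson
  obtain Z where Z: "finite Z" "\<And>y. \<exists>y'\<in>Z. \<forall>x. \<bar>g (x + y) - g (x + y')\<bar> \<le> e / 2"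
    using assms(2) e2 unfolding bochner_ap_def by meson
  define P where "P u v w \<longleftrightarrow> (\<forall>x. \<bar>f (x + w) - f (x + u)\<bar> \<le> e / 2 \<and> \<bar>g (x + w) - g (x + v)\<bar> \<le> e / 2)" for u v w
  define c where "c p = (SOME w. P (fst p) (snd p) w)" for p
  show ?thesis
  proof (rule that[of "c ` (Y \<times> Z)"])
    show "finite (c ` (Y \<times> Z))" using Y Z by simp
    fix y
    obtain u where u: "u \<in> Y" "\<forall>x. \<bar>f (x + y) - f (x + u)\<bar> \<le> e / 2" using Y(2) by blast
    obtain v where v: "v \<in> Z" "\<forall>x. \<bar>g (x + y) - g (x + v)\<bar> \<le> e / 2" using Z(2) by blast
    have "P u v y" using u v by (simp add: P_def)
    then have "P u v (c (u, v))" unfolding c_def fst_conv snd_conv by (rule someI)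
    then have c: "\<bar>f (x + c (u, v)) - f (x + u)\<bar> \<le> e / 2" "\<bar>g (x + c (u, v)) - g (x + v)\<bar> \<le> e / 2" for x
      by (auto simp: P_def)
    have "\<bar>f (x + y) - f (x + c (u, v))\<bar> \<le> e" for x
      using c(1)[of x] spec[OF u(2), of x] by linarith
    moreover have "\<bar>g (x + y) - g (x + c (u, v))\<bar> \<le> e" for x
      using c(2)[of x] spec[OF v(2), of x] by linarith
    ultimately show "\<exists>y'\<in>c ` (Y \<times> Z). \<forall>x. \<bar>f (x + y) - f (x + y')\<bar> \<le> e \<and> \<bar>g (x + y) - g (x + y')\<bar> \<le> e"
      using u(1) v(1) by (intro bexI[of _ "c (u, v)"]) auto
  qed
qed

lemma bochner_ap_const [simp]: "bochner_ap (\<lambda>x. c)"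
  unfolding bochner_ap_def by (auto intro!: exI[of _ "{0}"])

lemma bochner_ap_add:
  assumes "bochner_ap f" "bochner_ap g"
  shows "bochner_ap (\<lambda>x. f x + g x)"
  unfolding bochner_ap_def
proof (intro conjI allI impI)
  show "continuous_on UNIV (\<lambda>x. f x + g x)"
    using assms by (intro continuous_intros) (auto simp: bochner_ap_def)
  fix e :: real assume "e > 0"
  then have "e / 2 > 0" by simp
  from bochner_ap_common_net[OF assms this] obtain Y where Y: "finite Y"
    "\<And>y. \<exists>y'\<in>Y. \<forall>x. \<bar>f (x + y) - f (x + y')\<bar> \<le> e / 2 \<and> \<bar>g (x + y) - g (x + y')\<bar> \<le> e / 2" by metis
  have "\<exists>y'\<in>Y. \<forall>x. \<bar>f (x + y) + g (x + y) - (f (x + y') + g (x + y'))\<bar> \<le> e" for y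
  proof -
    obtain y' where y': "y' \<in> Y" "\<And>x. \<bar>f (x + y) - f (x + y')\<bar> \<le> e / 2" "\<And>x. \<bar>g (x + y) - g (x + y')\<bar> \<le> e / 2"
      using Y(2)[of y] by blast
    have "\<bar>f (x + y) + g (x + y) - (f (x + y') + g (x + y'))\<bar> \<le> e" for x
      using y'(2)[of x] y'(3)[of x] by linarith
    then show ?thesis using y'(1) by blast
  qed
  then show "\<exists>Y. finite Y \<and> (\<forall>y. \<exists>y'\<in>Y. \<forall>x. \<bar>f (x + y) + g (x + y) - (f (x + y') + g (x + y'))\<bar> \<le> e)"
    using Y(1) by blast
qed

lemma bochner_ap_mult:
  assumes "bochner_ap f" "bochner_ap g"
  shows "bochner_ap (\<lambda>x. f x * g x)"
  unfolding bochner_ap_def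
proof (intro conjI allI impI)
  show "continuous_on UNIV (\<lambda>x. f x * g x)"
    using assms by (intro continuous_intros) (auto simp: bochner_ap_def)
  fix e :: real assume e: "e > 0"
  obtain A where A: "A > 0" "\<And>x. \<bar>f x\<bar> \<le> A" using bochner_ap_bounded[OF assms(1)] by metis
  obtain B where B: "B > 0" "\<And>x. \<bar>g x\<bar> \<le> B" using bochner_ap_bounded[OF assms(2)] by metis
  define d where "d = e / (A + B)"
  have d: "d > 0" "d * A + d * B = e"
    using e A B by (auto simp: d_def add_divide_distrib[symmetric] distrib_left[symmetric])
  from bochner_ap_common_net[OF assms d(1)] obtain Y where Y: "finite Y"
    "\<And>y. \<exists>y'\<in>Y. \<forall>x. \<bar>f (x + y) - f (x + y')\<bar> \<le> d \<and> \<bar>g (x + y) - g (x + y')\<bar> \<le> d" by metis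
  have "\<exists>y'\<in>Y. \<forall>x. \<bar>f (x + y) * g (x + y) - f (x + y') * g (x + y')\<bar> \<le> e" for y
  proof -
    obtain y' where y': "y' \<in> Y" "\<And>x. \<bar>f (x + y) - f (x + y')\<bar> \<le> d" "\<And>x. \<bar>g (x + y) - g (x + y')\<bar> \<le> d"
      using Y(2)[of y] by blast
    have "\<bar>f (x + y) * g (x + y) - f (x + y') * g (x + y')\<bar> \<le> e" for x
    proof -
      have "f (x + y) * g (x + y) - f (x + y') * g (x + y') =
          (f (x + y) - f (x + y')) * g (x + y) + (g (x + y) - g (x + y')) * f (x + y')"
        by (simp add: algebra_simps)
      also have "\<bar>\<dots>\<bar> \<le> \<bar>f (x + y) - f (x + y')\<bar> * \<bar>g (x + y)\<bar> + \<bar>g (x + y) - g (x + y')\<bar> * \<bar>f (x + y')\<bar>"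
        by (metis abs_mult abs_triangle_ineq)
      also have "\<dots> \<le> d * B + d * A"
        using y'(2,3) A B d by (intro add_mono mult_mono) auto
      finally show ?thesis using d(2) by simp
    qed
    then show ?thesis using y'(1) by blast
  qed
  then show "\<exists>Y. finite Y \<and> (\<forall>y. \<exists>y'\<in>Y. \<forall>x. \<bar>f (x + y) * g (x + y) - f (x + y') * g (x + y')\<bar> \<le> e)"
    using Y(1) by blast
qed

lemma bochner_ap_cmul: "bochner_ap f \<Longrightarrow> bochner_ap (\<lambda>x. c * f x)"
  by (rule bochner_ap_mult[OF bochner_ap_const])

lemma bochner_ap_diff: "bochner_ap f \<Longrightarrow> bochner_ap g \<Longrightarrow> bochner_ap (\<lambda>x. f x - g x)"
  using bochner_ap_add[of f "\<lambda>x. (-1) * g x"] bochner_ap_cmul[of g "-1"] by simp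

lemma bochner_ap_power: "bochner_ap f \<Longrightarrow> bochner_ap (\<lambda>x. f x ^ n)"
  by (induction n) (auto intro: bochner_ap_mult)

text \<open>Almost periods bring both the translation vector and the argument into the cube [0,L]^d,
  so that only the values of \<open>f\<close> on the compact cube [0,2L]^d matter. There uniform
  continuity turns a finite cover of [0,L]^d into a net of translates.\<close>

lemma almost_periodic_imp_bochner_ap:
  fixes f :: "real ^ 'd \<Rightarrow> real"
  assumes "almost_periodic f"
  shows "bochner_ap f"
  unfolding bochner_ap_def
proof (intro conjI allI impI)
  show cont: "continuous_on UNIV f" using assms by (simp add: almost_periodic_def)
  fix e :: real assume "e > 0"
  \<comment> \<open>Four errors are added below: two for moving \<open>x + y\<close> by both almost
    periods, one for moving \<open>x + y'\<close> by one of them, one for uniform continuity. The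
    fifth part is slack.\<close>
  define \<epsilon> where "\<epsilon> = e / 5"
  have e: "\<epsilon> > 0" "e = 5 * \<epsilon>" using \<open>e > 0\<close> by (auto simp: \<epsilon>_def)
  obtain L where L: "L > 0" and
    per: "\<And>a. \<exists>\<zeta> \<in> cbox a (\<chi> i. a $ i + L). \<forall>r. \<bar>f (r - \<zeta>) - f r\<bar> < \<epsilon>"
    using assms e(1) unfolding almost_periodic_def by meson
  \<comment> \<open>The cube searched for an almost period has its upper corner at \<open>x\<close>,
    so that the difference falls into [0,L]^d.\<close>
  have red: "\<exists>\<zeta>. x - \<zeta> \<in> cbox 0 (\<chi> i. L) \<and> (\<forall>r. \<bar>f (r - \<zeta>) - f r\<bar> < \<epsilon>)" for x :: "real ^ 'd"
  proof -
    obtain \<zeta> where z: "\<zeta> \<in> cbox (x - (\<chi> i. L)) (\<chi> i. (x - (\<chi> i. L)) $ i + L)"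
      "\<forall>r. \<bar>f (r - \<zeta>) - f r\<bar> < \<epsilon>" using per[of "x - (\<chi> i. L)"] by blast
    have "x - \<zeta> \<in> cbox 0 (\<chi> i. L)"
      using z(1) by (auto simp: mem_box_cart) (smt (verit))
    then show ?thesis using z(2) by blast
  qed
  have "uniformly_continuous_on (cbox 0 (\<chi> i. 2 * L)) f"
    by (intro compact_uniformly_continuous continuous_on_subset[OF cont]) auto
  then obtain d where d: "d > 0" and
    uc: "\<And>x y. x \<in> cbox 0 (\<chi> i. 2 * L) \<Longrightarrow> y \<in> cbox 0 (\<chi> i. 2 * L) \<Longrightarrow> dist y x < d \<Longrightarrow>
      \<bar>f y - f x\<bar> < \<epsilon>"
    unfolding uniformly_continuous_on_def dist_real_def using e(1) by meson
  have "cbox 0 (\<chi> i. L) \<subseteq> (\<Union>y\<in>cbox 0 (\<chi> i. L) :: (real ^ 'd) set. ball y d)"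
    using d by force
  then obtain Y where Y: "Y \<subseteq> cbox 0 (\<chi> i. L)" "finite Y"
    "cbox 0 (\<chi> i. L) \<subseteq> (\<Union>y\<in>Y. ball y d :: (real ^ 'd) set)"
    using compactE_image[OF compact_cbox] open_ball by metis
  have "\<exists>y'\<in>Y. \<forall>x. \<bar>f (x + y) - f (x + y')\<bar> \<le> e" for y
  proof -
    obtain \<zeta> where z: "y - \<zeta> \<in> cbox 0 (\<chi> i. L)" "\<And>r. \<bar>f (r - \<zeta>) - f r\<bar> < \<epsilon>" using red by blast
    obtain y' where y': "y' \<in> Y" "dist y' (y - \<zeta>) < d" using z(1) Y(3) by auto
    have y'box: "y' \<in> cbox 0 (\<chi> i. L)" using y'(1) Y(1) by blast
    have "\<bar>f (x + y) - f (x + y')\<bar> \<le> e" for x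
    proof -
      obtain \<eta> where h: "x - \<eta> \<in> cbox 0 (\<chi> i. L)" "\<And>r. \<bar>f (r - \<eta>) - f r\<bar> < \<epsilon>" using red by blast
      have 1: "\<bar>f (x + y - \<zeta>) - f (x + y)\<bar> < \<epsilon>" by (rule z(2))
      have 2: "\<bar>f (x + y - \<zeta> - \<eta>) - f (x + y - \<zeta>)\<bar> < \<epsilon>" by (rule h(2))
      have 3: "\<bar>f (x + y' - \<eta>) - f (x + y')\<bar> < \<epsilon>" by (rule h(2))
      have "\<bar>f ((x - \<eta>) + y') - f ((x - \<eta>) + (y - \<zeta>))\<bar> < \<epsilon>"
      proof (rule uc)
        have "0 \<le> x $ i - \<eta> $ i \<and> x $ i - \<eta> $ i \<le> L" "0 \<le> y $ i - \<zeta> $ i \<and> y $ i - \<zeta> $ i \<le> L"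
             "0 \<le> y' $ i \<and> y' $ i \<le> L" for i
          using z(1) h(1) y'box by (simp_all add: mem_box_cart)
        note c = this
        show "(x - \<eta>) + (y - \<zeta>) \<in> cbox 0 (\<chi> i. 2 * L)"
          unfolding mem_box_cart using c by (auto simp: add_nonneg_nonneg) (smt (verit))+
        show "(x - \<eta>) + y' \<in> cbox 0 (\<chi> i. 2 * L)"
          unfolding mem_box_cart using c by (auto simp: add_nonneg_nonneg) (smt (verit))+
        show "dist (x - \<eta> + y') (x - \<eta> + (y - \<zeta>)) < d" using y'(2) by simp
      qed
      then have 4: "\<bar>f (x + y' - \<eta>) - f (x + y - \<zeta> - \<eta>)\<bar> < \<epsilon>"
        by (simp add: algebra_simps)
      show ?thesis using 1 2 3 4 e by linarith
    qed
    then show ?thesis using y'(1) by blast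
  qed
  then show "\<exists>Y. finite Y \<and> (\<forall>y. \<exists>y'\<in>Y. \<forall>x. \<bar>f (x + y) - f (x + y')\<bar> \<le> e)"
    using Y(2) by blast
qed

section \<open>Existence of the mean value\<close>

lemma cube_mean_continuous:
  fixes f :: "'a::topological_space \<Rightarrow> real ^ 'd \<Rightarrow> real"
  assumes "continuous_on UNIV (\<lambda>(y, x). f y x)"
  shows "continuous_on S (\<lambda>y. cube_mean \<rho> (f y))"
proof -
  have "continuous_on UNIV (\<lambda>y. integral (cbox (\<chi> i. - \<rho>) (\<chi> i. \<rho>)) (f y))"
    by (rule integral_continuous_on_param, rule continuous_on_subset[OF assms]) auto
  then show ?thesis
    unfolding cube_mean_def cube_def by (intro continuous_intros continuous_on_subset[where s = UNIV and t = S]) auto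
qed

lemma cube_mean_swap:
  fixes f :: "real ^ 'c \<Rightarrow> real ^ 'd \<Rightarrow> real"
  assumes "continuous_on UNIV (\<lambda>(y, x). f y x)"
  shows "cube_mean \<sigma> (\<lambda>y. cube_mean \<rho> (f y)) = cube_mean \<rho> (\<lambda>x. cube_mean \<sigma> (\<lambda>y. f y x))"
proof -
  have "integral (cube \<sigma>) (\<lambda>y. integral (cube \<rho>) (f y)) =
      integral (cube \<rho>) (\<lambda>x. integral (cube \<sigma>) (\<lambda>y. f y x))"
    unfolding cube_def
    by (rule integral_swap_continuous, rule continuous_on_subset[OF assms]) auto
  then show ?thesis by (simp add: cube_mean_def)
qed

text \<open>For a fixed translation this is the shift estimate; the finite net makes it uniform over
  all translations, however long. This uniformity permits averaging over the translation vector
  afterwards.\<close>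

lemma bochner_ap_mean_uniform:
  fixes F :: "real ^ 'd \<Rightarrow> real"
  assumes "bochner_ap F" "e > 0"
  shows "\<forall>\<^sub>F \<rho> in at_top. \<forall>y. \<bar>cube_mean \<rho> (\<lambda>x. F (x + y)) - cube_mean \<rho> F\<bar> \<le> e"
proof -
  have cont: "continuous_on UNIV F" by (rule bochner_ap_continuous[OF assms(1)])
  have conts: "continuous_on UNIV (\<lambda>x. F (x + y))" for y
    by (intro continuous_on_comp_UNIV[OF cont] continuous_intros)
  obtain B where B: "\<And>x. \<bar>F x\<bar> \<le> B" using bochner_ap_bounded[OF assms(1)] by metis
  obtain Y where Y: "finite Y" "\<And>y. \<exists>y'\<in>Y. \<forall>x. \<bar>F (x + y) - F (x + y')\<bar> \<le> e / 2"
    using assms unfolding bochner_ap_def by (meson half_gt_zero)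
  have "\<forall>\<^sub>F \<rho> in at_top. \<bar>cube_mean \<rho> (\<lambda>x. F (x + y)) - cube_mean \<rho> F\<bar> \<le> e / 2" for y
  proof -
    have "\<forall>\<^sub>F \<rho> in at_top. dist (2 * B * (1 - (1 - norm y / \<rho>) ^ CARD('d))) 0 < e / 2"
      using assms(2) by (intro tendstoD[OF shift_error_tendsto_0]) auto
    moreover have "\<forall>\<^sub>F \<rho> in at_top. norm y < \<rho>" by (rule eventually_gt_at_top)
    ultimately show ?thesis
    proof eventually_elim
      case (elim \<rho>)
      have "\<bar>cube_mean \<rho> (\<lambda>x. F (x + y)) - cube_mean \<rho> F\<bar> \<le> 2 * B * (1 - (1 - norm y / \<rho>) ^ CARD('d))"
        by (rule cube_mean_shift[OF cont B order_refl elim(2)])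
      then show ?case using elim(1) unfolding dist_real_def by linarith
    qed
  qed
  then have "\<forall>\<^sub>F \<rho> in at_top. \<forall>y\<in>Y. \<bar>cube_mean \<rho> (\<lambda>x. F (x + y)) - cube_mean \<rho> F\<bar> \<le> e / 2"
    using Y(1) by (simp add: eventually_ball_finite)
  moreover have "\<forall>\<^sub>F \<rho> :: real in at_top. 0 < \<rho>" by (rule eventually_gt_at_top)
  ultimately show ?thesis
  proof eventually_elim
    case (elim \<rho>)
    show ?case
    proof
      fix y
      obtain y' where y': "y' \<in> Y" "\<And>x. \<bar>F (x + y) - F (x + y')\<bar> \<le> e / 2" using Y(2) by blast
      have "\<bar>cube_mean \<rho> (\<lambda>x. F (x + y) - F (x + y'))\<bar> \<le> e / 2"
        by (intro cube_mean_bound continuous_on_diff conts y' elim)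
      then have "\<bar>cube_mean \<rho> (\<lambda>x. F (x + y)) - cube_mean \<rho> (\<lambda>x. F (x + y'))\<bar> \<le> e / 2"
        by (simp add: cube_mean_diff conts)
      moreover have "\<bar>cube_mean \<rho> (\<lambda>x. F (x + y')) - cube_mean \<rho> F\<bar> \<le> e / 2"
        using elim(1) y'(1) by blast
      ultimately show "\<bar>cube_mean \<rho> (\<lambda>x. F (x + y)) - cube_mean \<rho> F\<bar> \<le> e" by linarith
    qed
  qed
qed

text \<open>The mean over the cube \<open>\<rho>\<close> of the translate by \<open>y\<close>, averaged over \<open>y\<close> in the cube
  \<open>\<sigma>\<close>, is close to the mean over the cube \<open>\<rho>\<close>. It is symmetric in \<open>\<rho>\<close> and \<open>\<sigma>\<close>, hence also
  close to the mean over the cube \<open>\<sigma>\<close>.\<close>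

lemma bochner_ap_mean_cauchy:
  fixes F :: "real ^ 'd \<Rightarrow> real"
  assumes "bochner_ap F" "e > 0"
  obtains \<rho>\<^sub>0 where "\<And>\<rho> \<sigma>. \<rho> \<ge> \<rho>\<^sub>0 \<Longrightarrow> \<sigma> \<ge> \<rho>\<^sub>0 \<Longrightarrow> \<bar>cube_mean \<rho> F - cube_mean \<sigma> F\<bar> \<le> e"
proof -
  have cont: "continuous_on UNIV F" by (rule bochner_ap_continuous[OF assms(1)])
  have jc: "continuous_on UNIV (\<lambda>(y, x). F (x + y))" "continuous_on UNIV (\<lambda>(x, y). F (x + y))"
    unfolding split_beta by (intro continuous_on_comp_UNIV[OF cont] continuous_intros)+
  have "\<forall>\<^sub>F \<rho> in at_top. (\<forall>y. \<bar>cube_mean \<rho> (\<lambda>x. F (x + y)) - cube_mean \<rho> F\<bar> \<le> e / 2) \<and> 0 < \<rho>"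
    using bochner_ap_mean_uniform[OF assms(1), of "e / 2"] assms(2)
    by (intro eventually_conj eventually_gt_at_top) auto
  then obtain \<rho>\<^sub>0 where r0: "\<And>\<rho> y. \<rho> \<ge> \<rho>\<^sub>0 \<Longrightarrow> \<bar>cube_mean \<rho> (\<lambda>x. F (x + y)) - cube_mean \<rho> F\<bar> \<le> e / 2"
    "\<And>\<rho>. \<rho> \<ge> \<rho>\<^sub>0 \<Longrightarrow> \<rho> > 0"
    unfolding eventually_at_top_linorder by blast
  have key: "\<bar>cube_mean \<sigma> (\<lambda>y. cube_mean \<rho> (\<lambda>x. F (x + y))) - cube_mean \<rho> F\<bar> \<le> e / 2"
    if "\<rho> \<ge> \<rho>\<^sub>0" "\<sigma> \<ge> \<rho>\<^sub>0" for \<rho> \<sigma>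
  proof -
    have c: "continuous_on UNIV (\<lambda>y. cube_mean \<rho> (\<lambda>x. F (x + y)))"
      by (rule cube_mean_continuous[OF jc(1)])
    have "\<bar>cube_mean \<sigma> (\<lambda>y. cube_mean \<rho> (\<lambda>x. F (x + y)) - cube_mean \<rho> F)\<bar> \<le> e / 2"
      by (intro cube_mean_bound continuous_on_diff c continuous_on_const r0 that)
    then show ?thesis
      by (simp add: cube_mean_diff c cube_mean_const r0(2)[OF that(2)])
  qed
  show ?thesis
  proof
    fix \<rho> \<sigma> assume rs: "\<rho> \<ge> \<rho>\<^sub>0" "\<sigma> \<ge> \<rho>\<^sub>0"
    have "cube_mean \<sigma> (\<lambda>y. cube_mean \<rho> (\<lambda>x. F (x + y))) = cube_mean \<rho> (\<lambda>y. cube_mean \<sigma> (\<lambda>x. F (x + y)))"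
      using cube_mean_swap[OF jc(1), of \<sigma> \<rho>] by (simp add: add.commute)
    then show "\<bar>cube_mean \<rho> F - cube_mean \<sigma> F\<bar> \<le> e"
      using key[OF rs] key[OF rs(2) rs(1)] by linarith
  qed
qed

text \<open>Completeness gives the limit along the integers, and the Cauchy estimate carries it over
  to real side lengths.\<close>

lemma bochner_ap_mean_convergent:
  assumes "bochner_ap F"
  shows "\<exists>l. ((\<lambda>\<rho>. cube_mean \<rho> F) \<longlongrightarrow> l) at_top"
proof -
  have C: "Cauchy (\<lambda>n. cube_mean (real n) F)"
  proof (rule metric_CauchyI)
    fix e :: real assume "e > 0"
    then have "e / 2 > 0" by simp
    from bochner_ap_mean_cauchy[OF assms this] obtain \<rho>\<^sub>0 where
      r0: "\<And>\<rho> \<sigma>. \<rho> \<ge> \<rho>\<^sub>0 \<Longrightarrow> \<sigma> \<ge> \<rho>\<^sub>0 \<Longrightarrow> \<bar>cube_mean \<rho> F - cube_mean \<sigma> F\<bar> \<le> e / 2" by metis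
    obtain N where "\<rho>\<^sub>0 \<le> real N" using real_arch_simple by blast
    then have "real n \<ge> \<rho>\<^sub>0" if "n \<ge> N" for n using that by (meson of_nat_mono order_trans)
    then have "\<bar>cube_mean (real m) F - cube_mean (real n) F\<bar> < e" if "m \<ge> N" "n \<ge> N" for m n
      using r0[of "real m" "real n"] that \<open>e > 0\<close> by force
    then show "\<exists>M. \<forall>m\<ge>M. \<forall>n\<ge>M. dist (cube_mean (real m) F) (cube_mean (real n) F) < e"
      unfolding dist_real_def by blast
  qed
  then obtain l where l: "(\<lambda>n. cube_mean (real n) F) \<longlonglongrightarrow> l"
    using Cauchy_convergent_iff convergent_def by blast
  have "((\<lambda>\<rho>. cube_mean \<rho> F) \<longlongrightarrow> l) at_top"
  proof (rule tendstoI)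
    fix e :: real assume "e > 0"
    then have e2: "e / 2 > 0" by simp
    from bochner_ap_mean_cauchy[OF assms this] obtain \<rho>\<^sub>0 where
      r0: "\<And>\<rho> \<sigma>. \<rho> \<ge> \<rho>\<^sub>0 \<Longrightarrow> \<sigma> \<ge> \<rho>\<^sub>0 \<Longrightarrow> \<bar>cube_mean \<rho> F - cube_mean \<sigma> F\<bar> \<le> e / 2" by metis
    have "\<forall>\<^sub>F n in sequentially. dist (cube_mean (real n) F) l < e / 2 \<and> \<rho>\<^sub>0 \<le> real n"
      by (intro eventually_conj tendstoD[OF l e2]
          filterlim_at_top[THEN iffD1, rule_format, OF filterlim_real_sequentially])
    then obtain n where n: "dist (cube_mean (real n) F) l < e / 2" "\<rho>\<^sub>0 \<le> real n"
      using eventually_happens'[OF sequentially_bot] by blast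
    show "\<forall>\<^sub>F \<rho> in at_top. dist (cube_mean \<rho> F) l < e"
      using eventually_ge_at_top[of \<rho>\<^sub>0]
    proof eventually_elim
      case (elim \<rho>)
      show ?case using r0[OF elim n(2)] n(1) unfolding dist_real_def by linarith
    qed
  qed
  then show ?thesis by blast
qed

section \<open>The almost periodic inner product\<close>

text \<open>\<open>Lim\<close> is a total operator and says something only when the limit exists.
  Positivity and linearity of the inner product are derived from this convergence.\<close>

lemma ap_inner_tendsto:
  assumes "bochner_ap f" "bochner_ap g"
  shows "((\<lambda>\<rho>. cube_mean \<rho> (\<lambda>x. f x * g x)) \<longlongrightarrow> ap_inner f g) at_top"
proof -
  obtain l where l: "((\<lambda>\<rho>. cube_mean \<rho> (\<lambda>x. f x * g x)) \<longlongrightarrow> l) at_top"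
    using bochner_ap_mean_convergent[OF bochner_ap_mult[OF assms]] by blast
  then have "ap_inner f g = l"
    unfolding ap_inner_def cube_mean_def by (intro tendsto_Lim) simp_all
  then show ?thesis using l by simp
qed

lemma ap_inner_self_nonneg:
  assumes "bochner_ap f"
  shows "ap_inner f f \<ge> 0"
proof (rule tendsto_lowerbound[OF ap_inner_tendsto[OF assms assms]])
  \<comment> \<open>Zero is written as \<open>0 * f x\<close> so that homogeneity evaluates its mean
    for every \<open>\<rho>\<close>, without a sign condition.\<close>
  have "cube_mean \<rho> (\<lambda>x. 0 * f x) \<le> cube_mean \<rho> (\<lambda>x. f x * f x)" for \<rho>
    by (intro cube_mean_mono bochner_ap_continuous bochner_ap_cmul bochner_ap_mult assms) auto
  then have "cube_mean \<rho> (\<lambda>x. f x * f x) \<ge> 0" for \<rho>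
    unfolding cube_mean_cmul by simp
  then show "\<forall>\<^sub>F \<rho> in at_top. 0 \<le> cube_mean \<rho> (\<lambda>x. f x * f x)" by simp
qed simp

text \<open>The two-term form covers sums, differences and, with a zero coefficient, scalar
  multiples.\<close>

lemma ap_inner_combination:
  assumes "bochner_ap f" "bochner_ap g" "bochner_ap h"
  shows "ap_inner f (\<lambda>x. a * g x + b * h x) = a * ap_inner f g + b * ap_inner f h"
proof (rule tendsto_unique)
  show "((\<lambda>\<rho>. cube_mean \<rho> (\<lambda>x. f x * (a * g x + b * h x))) \<longlongrightarrow> ap_inner f (\<lambda>x. a * g x + b * h x)) at_top"
    by (intro ap_inner_tendsto bochner_ap_add bochner_ap_cmul assms)
  have c: "continuous_on UNIV (\<lambda>x. c * (f x * k x))" if "bochner_ap k" for c k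
    by (intro bochner_ap_continuous bochner_ap_cmul bochner_ap_mult assms that)
  have "cube_mean \<rho> (\<lambda>x. f x * (a * g x + b * h x)) =
      a * cube_mean \<rho> (\<lambda>x. f x * g x) + b * cube_mean \<rho> (\<lambda>x. f x * h x)" for \<rho>
    using cube_mean_add[OF c[OF assms(2)] c[OF assms(3)], of \<rho> a b]
    by (simp add: cube_mean_cmul algebra_simps)
  then show "((\<lambda>\<rho>. cube_mean \<rho> (\<lambda>x. f x * (a * g x + b * h x))) \<longlongrightarrow> a * ap_inner f g + b * ap_inner f h) at_top"
    by (auto intro!: tendsto_intros ap_inner_tendsto assms)
qed simp

section \<open>Averaging operators\<close>

text \<open>The parameter interval has length one whatever the length of \<open>v\<close>, so this
  is a genuine average over the segment from \<open>x\<close> to \<open>x + v\<close>.\<close>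

definition seg_op :: "real ^ 'd \<Rightarrow> (real ^ 'd \<Rightarrow> real) \<Rightarrow> real ^ 'd \<Rightarrow> real" where
  "seg_op v f = (\<lambda>x. integral {0..1} (\<lambda>s. f (x + s *\<^sub>R v)))"

text \<open>The algebra of convolutions generated by point masses and uniform measures on segments.
  Describing it by generators allows continuity, boundedness, linearity and commutation to be proved
  by induction.\<close>

inductive avg_op :: "((real ^ 'd \<Rightarrow> real) \<Rightarrow> real ^ 'd \<Rightarrow> real) \<Rightarrow> bool" where
  shift: "avg_op (\<lambda>f x. f (x + v))"
| seg: "avg_op (seg_op v)"
| add: "avg_op T \<Longrightarrow> avg_op U \<Longrightarrow> avg_op (\<lambda>f x. T f x + U f x)"
| cmul: "avg_op T \<Longrightarrow> avg_op (\<lambda>f x. c * T f x)"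
| comp: "avg_op T \<Longrightarrow> avg_op U \<Longrightarrow> avg_op (\<lambda>f. T (U f))"

lemma avg_op_ident: "avg_op (\<lambda>f. f)"
  using avg_op.shift[of 0] by simp

lemma avg_op_zero: "avg_op (\<lambda>f x. 0)"
  using avg_op.cmul[OF avg_op_ident, of 0] by simp

lemma avg_op_funpow: "avg_op T \<Longrightarrow> avg_op (T ^^ n)"
proof (induction n)
  case 0
  then show ?case using avg_op_ident by (simp add: id_def)
next
  case (Suc n)
  then show ?case using avg_op.comp[of T "T ^^ n"] by (simp add: comp_def)
qed

lemma continuous_seg:
  fixes f :: "real ^ 'd \<Rightarrow> real"
  assumes "continuous_on UNIV f"
  shows "continuous_on S (\<lambda>s :: real. f (x + s *\<^sub>R v))"
  by (intro continuous_on_comp_UNIV[OF assms] continuous_intros)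

lemma integrable_seg:
  fixes f :: "real ^ 'd \<Rightarrow> real"
  assumes "continuous_on UNIV f"
  shows "(\<lambda>s. f (x + s *\<^sub>R v)) integrable_on {0..1}"
  by (intro integrable_continuous_real continuous_seg assms)

lemma seg_op_continuous:
  fixes f :: "real ^ 'd \<Rightarrow> real"
  assumes "continuous_on UNIV f"
  shows "continuous_on UNIV (seg_op v f)"
proof -
  have "continuous_on UNIV (\<lambda>x. integral (cbox 0 1) (\<lambda>s. f (x + s *\<^sub>R v)))"
    by (rule integral_continuous_on_param, unfold split_beta)
       (intro continuous_on_comp_UNIV[OF assms] continuous_intros)
  then show ?thesis by (simp add: seg_op_def)
qed

lemma avg_op_continuous:
  assumes "avg_op T" "continuous_on UNIV f"
  shows "continuous_on UNIV (T f)"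
  using assms
proof (induction arbitrary: f rule: avg_op.induct)
  case (shift v)
  show ?case by (intro continuous_on_comp_UNIV[OF shift] continuous_intros)
next
  case (seg v)
  then show ?case by (rule seg_op_continuous)
qed (simp_all add: continuous_on_add continuous_on_mult)

section \<open>Locality and boundedness of averages\<close>

text \<open>The property of convolution with a probability measure on the ball of radius
  \<open>r\<close>, expressed without measures. Taking \<open>c = f x\<close> bounds the distance
  from \<open>T f\<close> to \<open>f\<close> by the oscillation of \<open>f\<close>; leaving
  \<open>c\<close> free is what lets the property pass to compositions, the radii being
  added.\<close>

definition local_avg :: "real \<Rightarrow> ((real ^ 'd \<Rightarrow> real) \<Rightarrow> real ^ 'd \<Rightarrow> real) \<Rightarrow> bool" where
  "local_avg r T \<longleftrightarrow> (\<forall>f x c e. continuous_on UNIV f \<longrightarrow>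
     (\<forall>y. norm y \<le> r \<longrightarrow> \<bar>f (x + y) - c\<bar> \<le> e) \<longrightarrow> \<bar>T f x - c\<bar> \<le> e)"

lemma local_avgD:
  assumes "local_avg r T" "continuous_on UNIV f" "\<And>y. norm y \<le> r \<Longrightarrow> \<bar>f (x + y) - c\<bar> \<le> e"
  shows "\<bar>T f x - c\<bar> \<le> e"
  using assms unfolding local_avg_def by blast

lemma local_avg_seg_op:
  fixes v :: "real ^ 'd"
  shows "local_avg (norm v) (seg_op v)"
  unfolding local_avg_def
proof (intro allI impI)
  fix f :: "real ^ 'd \<Rightarrow> real" and x :: "real ^ 'd" and c e :: real
  assume f: "continuous_on UNIV f" and e: "\<forall>y. norm y \<le> norm v \<longrightarrow> \<bar>f (x + y) - c\<bar> \<le> e"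
  have "norm (integral {0..1} (\<lambda>s. f (x + s *\<^sub>R v) - c)) \<le> e * (1 - 0)"
  proof (rule integral_bound)
    show "continuous_on {0..1} (\<lambda>s. f (x + s *\<^sub>R v) - c)"
      by (intro continuous_on_diff continuous_seg f continuous_on_const)
    fix s :: real assume "s \<in> {0..1}"
    then have "norm (s *\<^sub>R v) \<le> norm v" by (simp add: mult_left_le_one_le)
    then show "norm (f (x + s *\<^sub>R v) - c) \<le> e" using e by simp
  qed simp
  moreover have "integral {0..1} (\<lambda>s. f (x + s *\<^sub>R v) - c) = seg_op v f x - c"
    unfolding seg_op_def by (subst integral_diff) (auto intro: integrable_seg f)
  ultimately show "\<bar>seg_op v f x - c\<bar> \<le> e" by simp
qed

lemma local_avg_ident: "local_avg 0 (\<lambda>f. f)"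
  unfolding local_avg_def by (metis add.right_neutral norm_zero order_refl)

lemma local_avg_comp:
  fixes T U :: "(real ^ 'd \<Rightarrow> real) \<Rightarrow> real ^ 'd \<Rightarrow> real"
  assumes "local_avg r T" "local_avg s U" "avg_op U"
  shows "local_avg (r + s) (\<lambda>f. T (U f))"
  unfolding local_avg_def
proof (intro allI impI)
  fix f :: "real ^ 'd \<Rightarrow> real" and x :: "real ^ 'd" and c e :: real
  assume f: "continuous_on UNIV f" and e: "\<forall>y. norm y \<le> r + s \<longrightarrow> \<bar>f (x + y) - c\<bar> \<le> e"
  show "\<bar>T (U f) x - c\<bar> \<le> e"
  proof (rule local_avgD[OF assms(1)])
    show "continuous_on UNIV (U f)" by (rule avg_op_continuous[OF assms(3) f])
    fix y :: "real ^ 'd" assume y: "norm y \<le> r"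
    show "\<bar>U f (x + y) - c\<bar> \<le> e"
    proof (rule local_avgD[OF assms(2) f])
      fix z :: "real ^ 'd" assume "norm z \<le> s"
      then have "norm (y + z) \<le> r + s" using y norm_triangle_ineq[of y z] by linarith
      then show "\<bar>f (x + y + z) - c\<bar> \<le> e" using e by (simp add: add.assoc)
    qed
  qed
qed

lemma local_avg_funpow:
  assumes "local_avg r T" "avg_op T"
  shows "local_avg (real n * r) (T ^^ n)"
proof (induction n)
  case 0
  then show ?case using local_avg_ident by (simp add: id_def)
next
  case (Suc n)
  then show ?case
    using local_avg_comp[OF assms(1) Suc avg_op_funpow[OF assms(2)]]
    by (simp add: comp_def algebra_simps)
qed

lemma avg_op_bounded:
  assumes "avg_op T" "continuous_on UNIV f" "\<exists>B. \<forall>x. \<bar>f x\<bar> \<le> B"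
  shows "\<exists>B. \<forall>x. \<bar>T f x\<bar> \<le> B"
  using assms
proof (induction arbitrary: f rule: avg_op.induct)
  case (seg v)
  then obtain B where "\<And>x. \<bar>f x\<bar> \<le> B" by blast
  then have "\<bar>seg_op v f x - 0\<bar> \<le> B" for x
    by (intro local_avgD[OF local_avg_seg_op seg(1)]) simp
  then show ?case by auto
next
  case (add T U)
  obtain A B where "\<And>x. \<bar>T f x\<bar> \<le> A" "\<And>x. \<bar>U f x\<bar> \<le> B" using add by meson
  then have "\<bar>T f x + U f x\<bar> \<le> A + B" for x by (meson abs_triangle_ineq add_mono order_trans)
  then show ?case by blast
next
  case (cmul T c)
  obtain A where "\<And>x. \<bar>T f x\<bar> \<le> A" using cmul by meson
  then have "\<bar>c * T f x\<bar> \<le> \<bar>c\<bar> * A" for x by (simp add: abs_mult mult_left_mono)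
  then show ?case by blast
next
  case (comp T U)
  then show ?case using avg_op_continuous by blast
next
  case (shift v)
  then obtain B where "\<And>x. \<bar>f x\<bar> \<le> B" by blast
  then show ?case by (intro exI[of _ B]) simp
qed

section \<open>Linearity and commutation\<close>

lemma seg_op_add:
  assumes "continuous_on UNIV f" "continuous_on UNIV g"
  shows "seg_op v (\<lambda>x. f x + g x) x = seg_op v f x + seg_op v g x"
  unfolding seg_op_def by (intro integral_add integrable_seg assms)

lemma seg_op_cmul: "seg_op v (\<lambda>x. c * f x) x = c * seg_op v f x"
  unfolding seg_op_def by (simp add: integral_mult_right)

lemma avg_op_add:
  assumes "avg_op T" "continuous_on UNIV f" "continuous_on UNIV g"
  shows "T (\<lambda>x. f x + g x) = (\<lambda>x. T f x + T g x)"
  using assms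
proof (induction arbitrary: f g rule: avg_op.induct)
  case (seg v)
  then show ?case by (intro ext seg_op_add)
next
  case (cmul T c)
  then show ?case by (simp add: distrib_left)
next
  case (comp T U)
  then show ?case by (simp add: avg_op_continuous)
qed (simp_all add: add_ac)

lemma avg_op_cmul:
  assumes "avg_op T"
  shows "T (\<lambda>x. c * f x) = (\<lambda>x. c * T f x)"
  using assms
proof (induction arbitrary: f rule: avg_op.induct)
  case (seg v)
  then show ?case by (intro ext seg_op_cmul)
qed (simp_all add: distrib_left mult_ac)

lemma avg_op_shift_commute:
  assumes "avg_op T" "continuous_on UNIV f"
  shows "T (\<lambda>x. f (x + v)) = (\<lambda>x. T f (x + v))"
  using assms
proof (induction arbitrary: f rule: avg_op.induct)
  case (comp T U)
  then show ?case by (simp add: avg_op_continuous)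
qed (simp_all add: seg_op_def add_ac)

lemma seg_op_swap:
  fixes f :: "real ^ 'd \<Rightarrow> real"
  assumes "continuous_on UNIV f"
  shows "seg_op w (seg_op v f) = seg_op v (seg_op w f)"
proof
  fix x
  have "integral (cbox 0 1) (\<lambda>s. integral (cbox 0 1) (\<lambda>r. f (x + s *\<^sub>R w + r *\<^sub>R v))) =
      integral (cbox 0 1) (\<lambda>r. integral (cbox 0 1) (\<lambda>s. f (x + s *\<^sub>R w + r *\<^sub>R v)))"
    by (rule integral_swap_continuous, unfold split_beta)
       (intro continuous_on_comp_UNIV[OF assms] continuous_intros)
  then show "seg_op w (seg_op v f) x = seg_op v (seg_op w f) x"
    by (simp add: seg_op_def add_ac)
qed

lemma avg_op_seg_commute:
  assumes "avg_op T" "continuous_on UNIV f"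
  shows "T (seg_op v f) = seg_op v (T f)"
  using assms
proof (induction arbitrary: f rule: avg_op.induct)
  case (shift w)
  then show ?case by (simp add: seg_op_def add_ac)
next
  case (seg w)
  then show ?case by (rule seg_op_swap)
next
  case (add T U)
  then show ?case by (auto simp: seg_op_add avg_op_continuous)
next
  case (cmul T c)
  then show ?case by (auto simp: seg_op_cmul)
next
  case (comp T U)
  then show ?case by (simp add: avg_op_continuous)
qed

text \<open>Convolutions commute. Induction on \<open>U\<close> reduces the claim to shifts and
  segments, for which commutation with an arbitrary \<open>T\<close> was obtained by induction on
  \<open>T\<close>; two segments are interchanged by Fubini.\<close>

lemma avg_op_commute:
  assumes "avg_op U" "avg_op T" "continuous_on UNIV f"
  shows "T (U f) = U (T f)"
  using assms
proof (induction arbitrary: f rule: avg_op.induct)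
  case (shift v)
  then show ?case by (rule avg_op_shift_commute)
next
  case (seg v)
  then show ?case by (rule avg_op_seg_commute)
next
  case (add U V)
  then show ?case by (simp add: avg_op_add avg_op_continuous)
next
  case (cmul U c)
  then show ?case by (simp add: avg_op_cmul)
next
  case (comp U V)
  then show ?case by (simp add: avg_op_continuous)
qed

section \<open>Adjoints with respect to the mean\<close>

text \<open>Shift errors vanish in the mean for all bounded continuous functions, and this class is
  visibly preserved by \<open>avg_op\<close>. Almost periodicity of the averaged functions thus
  never has to be tracked.\<close>

definition bounded_cont :: "(real ^ 'd \<Rightarrow> real) \<Rightarrow> bool" where
  "bounded_cont f \<longleftrightarrow> continuous_on UNIV f \<and> (\<exists>B. \<forall>x. \<bar>f x\<bar> \<le> B)"

lemma avg_op_bounded_cont: "avg_op T \<Longrightarrow> bounded_cont f \<Longrightarrow> bounded_cont (T f)"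
  by (simp add: bounded_cont_def avg_op_continuous avg_op_bounded)

text \<open>A vanishing difference is required instead of equal limits, since the means of merely
  bounded continuous functions may diverge.\<close>

definition mean_adjoint ::
  "((real ^ 'd \<Rightarrow> real) \<Rightarrow> real ^ 'd \<Rightarrow> real) \<Rightarrow> ((real ^ 'd \<Rightarrow> real) \<Rightarrow> real ^ 'd \<Rightarrow> real) \<Rightarrow> bool" where
  "mean_adjoint T U \<longleftrightarrow> (\<forall>f g. bounded_cont f \<longrightarrow> bounded_cont g \<longrightarrow>
     ((\<lambda>\<rho>. cube_mean \<rho> (\<lambda>x. T f x * g x) - cube_mean \<rho> (\<lambda>x. f x * U g x)) \<longlongrightarrow> 0) at_top)"

lemma mean_adjointD:
  assumes "mean_adjoint T U" "bounded_cont f" "bounded_cont g"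
  shows "((\<lambda>\<rho>. cube_mean \<rho> (\<lambda>x. T f x * g x) - cube_mean \<rho> (\<lambda>x. f x * U g x)) \<longlongrightarrow> 0) at_top"
  using assms unfolding mean_adjoint_def by blast

lemma mean_adjoint_ident: "mean_adjoint (\<lambda>f. f) (\<lambda>f. f)"
  unfolding mean_adjoint_def by simp

lemma mean_adjoint_shift:
  fixes v :: "real ^ 'd"
  shows "mean_adjoint (\<lambda>f x. f (x + v)) (\<lambda>f x. f (x + - v))"
  unfolding mean_adjoint_def
proof (intro allI impI)
  fix f g :: "real ^ 'd \<Rightarrow> real" assume fg: "bounded_cont f" "bounded_cont g"
  then have c: "continuous_on UNIV f" "continuous_on UNIV g" by (auto simp: bounded_cont_def)
  obtain A B where AB: "\<And>x. \<bar>f x\<bar> \<le> A" "\<And>x. \<bar>g x\<bar> \<le> B" using fg unfolding bounded_cont_def by metis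
  \<comment> \<open>With this product, \<open>f (x + v) * g x\<close> is \<open>F (x + v)\<close>,
    so the two means differ only by a translation of the argument.\<close>
  define F where "F x = f x * g (x + - v)" for x
  have F: "continuous_on UNIV F" unfolding F_def
    by (intro continuous_on_mult c continuous_on_comp_UNIV[OF c(2)] continuous_intros)
  have FB: "\<bar>F x\<bar> \<le> A * B" for x unfolding F_def abs_mult
    by (rule mult_mono[OF AB order_trans[OF abs_ge_zero AB(1)] abs_ge_zero])
  have "\<forall>\<^sub>F \<rho> in at_top. norm (cube_mean \<rho> (\<lambda>x. F (x + v)) - cube_mean \<rho> F) \<le>
      2 * (A * B) * (1 - (1 - norm v / \<rho>) ^ CARD('d))"
    using eventually_gt_at_top[of "norm v"]
    by eventually_elim (auto intro!: cube_mean_shift[OF F FB])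
  then have "((\<lambda>\<rho>. cube_mean \<rho> (\<lambda>x. F (x + v)) - cube_mean \<rho> F) \<longlongrightarrow> 0) at_top"
    by (rule Lim_null_comparison) (rule shift_error_tendsto_0)
  then show "((\<lambda>\<rho>. cube_mean \<rho> (\<lambda>x. f (x + v) * g x) - cube_mean \<rho> (\<lambda>x. f x * g (x + - v))) \<longlongrightarrow> 0) at_top"
    by (simp add: F_def[abs_def])
qed

lemma cube_mean_seg:
  fixes f :: "real \<Rightarrow> real ^ 'd \<Rightarrow> real"
  assumes "continuous_on UNIV (\<lambda>(s, x). f s x)"
  shows "cube_mean \<rho> (\<lambda>x. integral {0..1} (\<lambda>s. f s x)) = integral {0..1} (\<lambda>s. cube_mean \<rho> (f s))"
proof -
  have "integral (cbox 0 1) (\<lambda>s. integral (cube \<rho>) (f s)) =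
      integral (cube \<rho>) (\<lambda>x. integral (cbox 0 1) (\<lambda>s. f s x))"
    unfolding cube_def
    by (rule integral_swap_continuous, rule continuous_on_subset[OF assms]) auto
  then show ?thesis by (simp add: cube_mean_def integral_mult_right divide_inverse mult.commute)
qed

text \<open>The shift by \<open>s *\<^sub>R v\<close> has the opposite shift as adjoint. The error
  bound at \<open>norm v\<close> serves for all \<open>s\<close> in the unit interval, so it
  survives integration over \<open>s\<close>.\<close>

lemma mean_adjoint_seg:
  fixes v :: "real ^ 'd"
  shows "mean_adjoint (seg_op v) (seg_op (- v))"
  unfolding mean_adjoint_def
proof (intro allI impI)
  fix f g :: "real ^ 'd \<Rightarrow> real" assume fg: "bounded_cont f" "bounded_cont g"
  then have c: "continuous_on UNIV f" "continuous_on UNIV g" by (auto simp: bounded_cont_def)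
  obtain A B where AB: "\<And>x. \<bar>f x\<bar> \<le> A" "\<And>x. \<bar>g x\<bar> \<le> B" using fg unfolding bounded_cont_def by metis
  define F where "F s x = f x * g (x - s *\<^sub>R v)" for s x
  have F: "continuous_on UNIV (F s)" for s unfolding F_def
    by (intro continuous_on_mult c continuous_on_comp_UNIV[OF c(2)] continuous_intros)
  have jc: "continuous_on UNIV (\<lambda>(s, x). F s x)" "continuous_on UNIV (\<lambda>(s, x). F s (x + s *\<^sub>R v))"
    unfolding F_def split_beta
    by (rule continuous_on_mult[OF continuous_on_comp_UNIV[OF c(1)] continuous_on_comp_UNIV[OF c(2)]];
        intro continuous_intros)+
  have FB: "\<bar>F s x\<bar> \<le> A * B" for s x unfolding F_def abs_mult
    by (rule mult_mono[OF AB order_trans[OF abs_ge_zero AB(1)] abs_ge_zero])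
  have 1: "cube_mean \<rho> (\<lambda>x. seg_op v f x * g x) = integral {0..1} (\<lambda>s. cube_mean \<rho> (\<lambda>x. F s (x + s *\<^sub>R v)))" for \<rho>
    using cube_mean_seg[OF jc(2), of \<rho>] by (simp add: F_def seg_op_def integral_mult_left)
  have 2: "cube_mean \<rho> (\<lambda>x. f x * seg_op (- v) g x) = integral {0..1} (\<lambda>s. cube_mean \<rho> (F s))" for \<rho>
    using cube_mean_seg[OF jc(1), of \<rho>] by (simp add: F_def[abs_def] seg_op_def integral_mult_right)
  have mc: "continuous_on {0..1} (\<lambda>s. cube_mean \<rho> (F s))"
    "continuous_on {0..1} (\<lambda>s. cube_mean \<rho> (\<lambda>x. F s (x + s *\<^sub>R v)))" for \<rho>
    by (rule cube_mean_continuous[OF jc(1)], rule cube_mean_continuous[OF jc(2)])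
  have "\<bar>integral {0..1} (\<lambda>s. cube_mean \<rho> (\<lambda>x. F s (x + s *\<^sub>R v)) - cube_mean \<rho> (F s))\<bar> \<le>
      2 * (A * B) * (1 - (1 - norm v / \<rho>) ^ CARD('d)) * (1 - 0)" if "norm v < \<rho>" for \<rho>
  proof (subst real_norm_def[symmetric], rule integral_bound)
    show "continuous_on {0..1} (\<lambda>s. cube_mean \<rho> (\<lambda>x. F s (x + s *\<^sub>R v)) - cube_mean \<rho> (F s))"
      by (intro continuous_on_diff mc)
    fix s :: real assume "s \<in> {0..1}"
    then have "norm (s *\<^sub>R v) \<le> norm v" by (simp add: mult_left_le_one_le)
    then show "norm (cube_mean \<rho> (\<lambda>x. F s (x + s *\<^sub>R v)) - cube_mean \<rho> (F s)) \<le>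
        2 * (A * B) * (1 - (1 - norm v / \<rho>) ^ CARD('d))"
      unfolding real_norm_def by (intro cube_mean_shift[OF F FB _ that])
  qed simp
  then have "\<forall>\<^sub>F \<rho> in at_top. norm (cube_mean \<rho> (\<lambda>x. seg_op v f x * g x) - cube_mean \<rho> (\<lambda>x. f x * seg_op (- v) g x)) \<le>
      2 * (A * B) * (1 - (1 - norm v / \<rho>) ^ CARD('d))"
    unfolding 1 2
    by (auto intro!: eventually_mono[OF eventually_gt_at_top[of "norm v"]] simp: integral_diff[OF integrable_continuous_real integrable_continuous_real, OF mc(2) mc(1)])
  then show "((\<lambda>\<rho>. cube_mean \<rho> (\<lambda>x. seg_op v f x * g x) - cube_mean \<rho> (\<lambda>x. f x * seg_op (- v) g x)) \<longlongrightarrow> 0) at_top"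
    by (rule Lim_null_comparison) (rule shift_error_tendsto_0)
qed

lemma mean_adjoint_comp:
  fixes T T' U U' :: "(real ^ 'd \<Rightarrow> real) \<Rightarrow> real ^ 'd \<Rightarrow> real"
  assumes "mean_adjoint T T'" "mean_adjoint U U'" "avg_op T'" "avg_op U"
  shows "mean_adjoint (\<lambda>f. T (U f)) (\<lambda>f. U' (T' f))"
  unfolding mean_adjoint_def
proof (intro allI impI)
  fix f g :: "real ^ 'd \<Rightarrow> real" assume fg: "bounded_cont f" "bounded_cont g"
  from tendsto_add[OF mean_adjointD[OF assms(1) avg_op_bounded_cont[OF assms(4) fg(1)] fg(2)]
    mean_adjointD[OF assms(2) fg(1) avg_op_bounded_cont[OF assms(3) fg(2)]]]
  show "((\<lambda>\<rho>. cube_mean \<rho> (\<lambda>x. T (U f) x * g x) - cube_mean \<rho> (\<lambda>x. f x * U' (T' g) x)) \<longlongrightarrow> 0) at_top"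
    by simp
qed

lemma mean_adjoint_add:
  fixes T T' U U' :: "(real ^ 'd \<Rightarrow> real) \<Rightarrow> real ^ 'd \<Rightarrow> real"
  assumes "mean_adjoint T T'" "mean_adjoint U U'" "avg_op T" "avg_op U" "avg_op T'" "avg_op U'"
  shows "mean_adjoint (\<lambda>f x. T f x + U f x) (\<lambda>f x. T' f x + U' f x)"
  unfolding mean_adjoint_def
proof (intro allI impI)
  fix f g :: "real ^ 'd \<Rightarrow> real" assume fg: "bounded_cont f" "bounded_cont g"
  then have c: "continuous_on UNIV f" "continuous_on UNIV g" by (auto simp: bounded_cont_def)
  have "cube_mean \<rho> (\<lambda>x. (T f x + U f x) * g x) =
      cube_mean \<rho> (\<lambda>x. T f x * g x) + cube_mean \<rho> (\<lambda>x. U f x * g x)" for \<rho>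
    unfolding distrib_right
    by (intro cube_mean_add continuous_on_mult c assms(3-6)[THEN avg_op_continuous])
  moreover have "cube_mean \<rho> (\<lambda>x. f x * (T' g x + U' g x)) =
      cube_mean \<rho> (\<lambda>x. f x * T' g x) + cube_mean \<rho> (\<lambda>x. f x * U' g x)" for \<rho>
    unfolding distrib_left
    by (intro cube_mean_add continuous_on_mult c assms(3-6)[THEN avg_op_continuous])
  ultimately show "((\<lambda>\<rho>. cube_mean \<rho> (\<lambda>x. (T f x + U f x) * g x) -
      cube_mean \<rho> (\<lambda>x. f x * (T' g x + U' g x))) \<longlongrightarrow> 0) at_top"
    using tendsto_add[OF mean_adjointD[OF assms(1) fg] mean_adjointD[OF assms(2) fg]]
    by (simp add: algebra_simps)
qed

lemma mean_adjoint_cmul: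
  fixes T T' :: "(real ^ 'd \<Rightarrow> real) \<Rightarrow> real ^ 'd \<Rightarrow> real"
  assumes "mean_adjoint T T'"
  shows "mean_adjoint (\<lambda>f x. c * T f x) (\<lambda>f x. c * T' f x)"
  unfolding mean_adjoint_def
proof (intro allI impI)
  fix f g :: "real ^ 'd \<Rightarrow> real" assume fg: "bounded_cont f" "bounded_cont g"
  have "cube_mean \<rho> (\<lambda>x. c * T f x * g x) = c * cube_mean \<rho> (\<lambda>x. T f x * g x)" for \<rho>
    by (simp add: cube_mean_cmul[symmetric] mult.assoc)
  moreover have "cube_mean \<rho> (\<lambda>x. f x * (c * T' g x)) = c * cube_mean \<rho> (\<lambda>x. f x * T' g x)" for \<rho>
    by (simp add: cube_mean_cmul[symmetric] mult.left_commute)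
  ultimately show "((\<lambda>\<rho>. cube_mean \<rho> (\<lambda>x. c * T f x * g x) -
      cube_mean \<rho> (\<lambda>x. f x * (c * T' g x))) \<longlongrightarrow> 0) at_top"
    using tendsto_mult_right_zero[OF mean_adjointD[OF assms fg], of c]
    by (simp add: algebra_simps)
qed

text \<open>Taking adjoints reverses the order of a product, and commutation restores it.\<close>

lemma mean_adjoint_comp_self:
  assumes "mean_adjoint T T" "mean_adjoint U U" "avg_op T" "avg_op U"
  shows "mean_adjoint (\<lambda>f. T (U f)) (\<lambda>f. T (U f))"
proof -
  have "T (U g) = U (T g)" if "bounded_cont g" for g
    by (intro avg_op_commute assms) (use that in \<open>simp add: bounded_cont_def\<close>)
  then show ?thesis
    using mean_adjoint_comp[OF assms] unfolding mean_adjoint_def by simp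
qed

section \<open>Symmetry of the operator G\<close>

text \<open>\<open>partial_derivative\<close> differentiates at parameter 0 only; moving the base
  point along the line yields the derivative at every parameter, as the fundamental theorem of
  calculus requires.\<close>

lemma has_partial_derivative:
  assumes "(\<lambda>t. f ((r + s *\<^sub>R axis i 1) + t *\<^sub>R axis i 1)) field_differentiable (at 0)"
  shows "((\<lambda>t. f (r + t *\<^sub>R axis i 1)) has_field_derivative partial_derivative i f (r + s *\<^sub>R axis i 1)) (at s)"
proof -
  have "((\<lambda>t. f ((r + s *\<^sub>R axis i 1) + t *\<^sub>R axis i 1)) has_field_derivative
      partial_derivative i f (r + s *\<^sub>R axis i 1)) (at 0)"
    unfolding partial_derivative_def using assms by (simp add: DERIV_deriv_iff_field_differentiable)
  moreover have "(r + s *\<^sub>R axis i 1) + t *\<^sub>R axis i 1 = r + (t + s) *\<^sub>R axis i 1" for t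
    by (simp add: scaleR_add_left add_ac)
  ultimately show ?thesis
    using DERIV_shift[of "\<lambda>t. f (r + t *\<^sub>R axis i 1)" _ 0 s] by simp
qed

text \<open>The fundamental theorem of calculus along the segment. The resulting difference quotient
  is bounded for bounded \<open>f\<close>, even when the derivative is not.\<close>

lemma seg_op_partial_derivative:
  fixes f :: "real ^ 'd \<Rightarrow> real"
  assumes "\<And>r. (\<lambda>t. f (r + t *\<^sub>R axis i 1)) field_differentiable (at 0)" "h \<noteq> 0"
  shows "seg_op (h *\<^sub>R axis i 1) (partial_derivative i f) x = 1 / h * (f (x + h *\<^sub>R axis i 1) - f x)"
proof -
  have "((\<lambda>s. f (x + (s * h) *\<^sub>R axis i 1)) has_real_derivative
      partial_derivative i f (x + (s * h) *\<^sub>R axis i 1) * h) (at s)" for s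
    by (rule DERIV_chain2[OF has_partial_derivative[OF assms(1)]])
       (auto intro!: derivative_eq_intros)
  then have "((\<lambda>s. partial_derivative i f (x + (s * h) *\<^sub>R axis i 1) * h) has_integral
      (f (x + (1 * h) *\<^sub>R axis i 1) - f (x + (0 * h) *\<^sub>R axis i 1))) {0..1}"
    by (intro fundamental_theorem_of_calculus)
       (auto simp: has_real_derivative_iff_has_vector_derivative intro: has_vector_derivative_at_within)
  from has_integral_mult_left[OF this, of "1 / h"]
  have "((\<lambda>s. partial_derivative i f (x + s *\<^sub>R h *\<^sub>R axis i 1)) has_integral
      1 / h * (f (x + h *\<^sub>R axis i 1) - f x)) {0..1}"
    using assms(2) by (simp add: mult.commute)
  then show ?thesis unfolding seg_op_def by (rule integral_unique)
qed

lemma C_class_continuous: "C_class k f \<Longrightarrow> continuous_on UNIV f"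
  by (cases k) auto

lemma C_class_mono: "C_class (k + j) f \<Longrightarrow> C_class k f"
proof (induction k arbitrary: f)
  case 0
  then show ?case by (simp add: C_class_continuous)
qed simp

lemma partial_derivative_combination:
  assumes "(\<lambda>t. f (r + t *\<^sub>R axis i 1)) field_differentiable (at 0)"
    "(\<lambda>t. g (r + t *\<^sub>R axis i 1)) field_differentiable (at 0)"
  shows "partial_derivative i (\<lambda>x. a * f x + b * g x) r =
    a * partial_derivative i f r + b * partial_derivative i g r"
  unfolding partial_derivative_def using assms unfolding DERIV_deriv_iff_field_differentiable[symmetric]
  by (intro DERIV_imp_deriv DERIV_add DERIV_cmult)

lemma C_class_combination:
  "C_class k f \<Longrightarrow> C_class k g \<Longrightarrow> C_class k (\<lambda>x. a * f x + b * g x)"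
proof (induction k arbitrary: f g)
  case 0
  then show ?case by (auto intro!: continuous_intros)
next
  case (Suc k)
  then have diff: "(\<lambda>t. f (r + t *\<^sub>R axis i 1)) field_differentiable (at 0)"
    "(\<lambda>t. g (r + t *\<^sub>R axis i 1)) field_differentiable (at 0)" for i r by auto
  have "(\<lambda>t. a * f (r + t *\<^sub>R axis i 1) + b * g (r + t *\<^sub>R axis i 1)) field_differentiable (at 0)" for i r
    using diff[THEN field_differentiable_mult[OF field_differentiable_const]]
    by (intro field_differentiable_add) auto
  moreover have "C_class k (partial_derivative i (\<lambda>x. a * f x + b * g x))" for i
    unfolding partial_derivative_combination[OF diff, abs_def] using Suc by simp
  ultimately show ?case using Suc.prems by (auto intro!: continuous_intros)
qed

lemma C_class_zero: "C_class k (\<lambda>x. 0)"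
  by (induction k) (auto simp: partial_derivative_def[abs_def])

lemma C_class_sum:
  assumes "\<And>i. i \<in> I \<Longrightarrow> C_class k (f i)"
  shows "C_class k (\<lambda>x. \<Sum>i\<in>I. f i x)"
  using assms
proof (induction I rule: infinite_finite_induct)
  case (insert i I)
  then show ?case using C_class_combination[of k "f i" "\<lambda>x. \<Sum>i\<in>I. f i x" 1 1] by simp
qed (simp_all add: C_class_zero)

lemma C_class_second_partial: "C_class (Suc (Suc k)) f \<Longrightarrow> C_class k (partial_derivative i (partial_derivative i f))"
  by simp

lemma laplacian_combination:
  assumes "C_class 2 f" "C_class 2 g"
  shows "laplacian (\<lambda>x. a * f x + b * g x) = (\<lambda>x. a * laplacian f x + b * laplacian g x)"
proof -
  have "partial_derivative i (partial_derivative i (\<lambda>x. a * f x + b * g x)) =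
      (\<lambda>x. a * partial_derivative i (partial_derivative i f) x + b * partial_derivative i (partial_derivative i g) x)" for i
  proof -
    have "partial_derivative i (\<lambda>x. a * f x + b * g x) =
        (\<lambda>x. a * partial_derivative i f x + b * partial_derivative i g x)"
      by (intro ext partial_derivative_combination) (use assms in \<open>simp_all add: numeral_2_eq_2\<close>)
    moreover have "partial_derivative i (\<lambda>x. a * partial_derivative i f x + b * partial_derivative i g x) =
      (\<lambda>x. a * partial_derivative i (partial_derivative i f) x + b * partial_derivative i (partial_derivative i g) x)"
      by (intro ext partial_derivative_combination) (use assms in \<open>simp_all add: numeral_2_eq_2\<close>)
    ultimately show ?thesis by simp
  qed
  then show ?thesis by (simp add: laplacian_def[abs_def] sum.distrib sum_distrib_left)
qed

lemma C_class_laplacian: "C_class (Suc (Suc k)) f \<Longrightarrow> C_class k (laplacian f)"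
  unfolding laplacian_def[abs_def] by (intro C_class_sum C_class_second_partial)

text \<open>Each factor uses up two orders of differentiability. The spare order \<open>k\<close> is
  general because the induction needs two more of them for the inner operator.\<close>

lemma C_class_G_op: "C_class (2 * m + k) f \<Longrightarrow> C_class k (G_op q m f)"
proof (induction m arbitrary: k)
  case (Suc m)
  have "C_class (2 * m + Suc (Suc k)) f" using Suc.prems by (simp only: mult_Suc_right add_Suc_right add_2_eq_Suc add_Suc)
  then have "C_class (Suc (Suc k)) (G_op q m f)" by (rule Suc.IH)
  then show ?case
    using C_class_combination[OF C_class_laplacian C_class_mono[of k 2], of _ _ 1 "(q (Suc m))\<^sup>2"] by simp
qed simp

text \<open>Smoothness enters even into linearity, since \<open>deriv\<close> has an unspecified
  value where no derivative exists.\<close>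

lemma G_op_combination:
  "C_class (2 * m) f \<Longrightarrow> C_class (2 * m) g \<Longrightarrow>
    G_op q m (\<lambda>x. a * f x + b * g x) = (\<lambda>x. a * G_op q m f x + b * G_op q m g x)"
proof (induction m)
  case (Suc m)
  have C: "C_class (2 * m + 2) f" "C_class (2 * m + 2) g" using Suc.prems by simp_all
  have "G_op q m (\<lambda>x. a * f x + b * g x) = (\<lambda>x. a * G_op q m f x + b * G_op q m g x)"
    using C by (intro Suc.IH) (blast intro: C_class_mono)+
  then show ?case
    using laplacian_combination[OF C[THEN C_class_G_op]] by (simp add: algebra_simps)
qed simp

section \<open>Averaged derivatives as finite differences\<close>

text \<open>Convolution with a triangular kernel in one coordinate. The two segments point in
  opposite directions so that passing to the adjoint, which reverses both directions and the order,
  reproduces the operator.\<close>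

definition seg2_op :: "real \<Rightarrow> 'd \<Rightarrow> (real ^ 'd \<Rightarrow> real) \<Rightarrow> real ^ 'd \<Rightarrow> real" where
  "seg2_op h i f = seg_op (h *\<^sub>R axis i 1) (seg_op (- (h *\<^sub>R axis i 1)) f)"

text \<open>The central second difference quotient, spelled as a sum of scaled shifts to match the
  rules for \<open>avg_op\<close> and \<open>mean_adjoint\<close>.\<close>

definition diff2_op :: "real \<Rightarrow> 'd \<Rightarrow> (real ^ 'd \<Rightarrow> real) \<Rightarrow> real ^ 'd \<Rightarrow> real" where
  "diff2_op h i f x = 1 / h\<^sup>2 * (f (x + h *\<^sub>R axis i 1) + (f (x + - (h *\<^sub>R axis i 1)) + - 2 * f x))"

lemma avg_op_seg2_op: "avg_op (seg2_op h i)"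
  and mean_adjoint_seg2_op: "mean_adjoint (seg2_op h i) (seg2_op h i)"
  and local_avg_seg2_op: "local_avg (2 * \<bar>h\<bar>) (seg2_op h i)"
proof -
  let ?v = "h *\<^sub>R axis i 1"
  have e: "seg2_op h i = (\<lambda>f. seg_op ?v (seg_op (- ?v) f))" by (auto simp: seg2_op_def)
  show "avg_op (seg2_op h i)" unfolding e by (rule avg_op.comp[OF avg_op.seg avg_op.seg])
  show "mean_adjoint (seg2_op h i) (seg2_op h i)"
    unfolding e
    using mean_adjoint_comp[OF mean_adjoint_seg[of ?v] mean_adjoint_seg[of "- ?v"] avg_op.seg avg_op.seg] by simp
  show "local_avg (2 * \<bar>h\<bar>) (seg2_op h i)"
    unfolding e
    using local_avg_comp[OF local_avg_seg_op[of ?v] local_avg_seg_op[of "- ?v"] avg_op.seg] by simp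
qed

lemma avg_op_diff2_op: "avg_op (diff2_op h i)"
  and mean_adjoint_diff2_op: "mean_adjoint (diff2_op h i) (diff2_op h i)"
proof -
  let ?v = "h *\<^sub>R axis i 1"
  have e: "diff2_op h i = (\<lambda>f x. 1 / h\<^sup>2 * (f (x + ?v) + (f (x + - ?v) + - 2 * f x)))"
    by (intro ext) (simp add: diff2_op_def)
  note cid = avg_op.cmul[OF avg_op_ident]
  note sh = avg_op.shift
  show "avg_op (diff2_op h i)"
    unfolding e by (rule avg_op.cmul[OF avg_op.add[OF sh avg_op.add[OF sh cid]]])
  have "mean_adjoint (diff2_op h i) (\<lambda>f x. 1 / h\<^sup>2 * (f (x + - ?v) + (f (x + - (- ?v)) + - 2 * f x)))"
    unfolding e
    by (rule mean_adjoint_cmul[OF mean_adjoint_add[OF mean_adjoint_shift mean_adjoint_add[OF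
          mean_adjoint_shift mean_adjoint_cmul[OF mean_adjoint_ident] sh cid sh cid]
          sh avg_op.add[OF sh cid] sh avg_op.add[OF sh cid]]])
  then show "mean_adjoint (diff2_op h i) (diff2_op h i)" unfolding e by (simp add: algebra_simps)
qed

lemma seg2_op_second_partial:
  fixes f :: "real ^ 'd \<Rightarrow> real"
  assumes "C_class 2 f" "h \<noteq> 0"
  shows "seg2_op h i (partial_derivative i (partial_derivative i f)) = diff2_op h i f"
proof
  fix x
  let ?v = "h *\<^sub>R axis i 1" and ?g = "partial_derivative i f"
  have f: "\<And>r. (\<lambda>t. f (r + t *\<^sub>R axis i 1)) field_differentiable (at 0)"
    and g: "\<And>r. (\<lambda>t. ?g (r + t *\<^sub>R axis i 1)) field_differentiable (at 0)"
    and c: "continuous_on UNIV ?g"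
    using assms(1) by (simp_all add: numeral_2_eq_2)
  have c2: "continuous_on UNIV (\<lambda>x. - 1 * ?g (x + - ?v))"
    by (intro continuous_on_mult continuous_on_const continuous_on_comp_UNIV[OF c] continuous_intros)
  \<comment> \<open>The inner average, with step \<open>- h\<close>, leaves a backward difference
    quotient of the first derivative. The outer average turns both of its terms into difference
    quotients of \<open>f\<close>.\<close>
  have "seg_op (- ?v) (partial_derivative i ?g) = (\<lambda>y. 1 / h * (?g y + - 1 * ?g (y + - ?v)))"
    using seg_op_partial_derivative[OF g, of "- h"] assms(2) by (intro ext) (simp add: field_simps)
  then have "seg2_op h i (partial_derivative i ?g) x =
      1 / h * (seg_op ?v ?g x + - 1 * seg_op ?v ?g (x + - ?v))"
    unfolding seg2_op_def
    by (simp only: seg_op_cmul seg_op_add[OF c c2] avg_op_shift_commute[OF avg_op.seg c])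
  also have "\<dots> = diff2_op h i f x"
    unfolding seg_op_partial_derivative[OF f assms(2)] diff2_op_def using assms(2)
    by (simp add: field_simps power2_eq_square)
  finally show "seg2_op h i (partial_derivative i ?g) x = diff2_op h i f x" .
qed

text \<open>A second derivative has to be averaged in its own direction. Averaging in all directions
  gives the terms of the Laplacian one common average.\<close>

primrec box_op :: "real \<Rightarrow> 'd list \<Rightarrow> (real ^ 'd \<Rightarrow> real) \<Rightarrow> real ^ 'd \<Rightarrow> real" where
  "box_op h [] = (\<lambda>f. f)"
| "box_op h (i # is) = (\<lambda>f. seg2_op h i (box_op h is f))"

text \<open>Expanded, this is the sum over the listed directions of the second difference in that
  direction composed with the averages in all the others; the recursion has the shape of a product
  rule.\<close>

primrec lap_op :: "real \<Rightarrow> 'd list \<Rightarrow> (real ^ 'd \<Rightarrow> real) \<Rightarrow> real ^ 'd \<Rightarrow> real" where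
  "lap_op h [] = (\<lambda>f x. 0)"
| "lap_op h (i # is) = (\<lambda>f x. seg2_op h i (lap_op h is f) x + diff2_op h i (box_op h is f) x)"

lemma avg_op_box_op: "avg_op (box_op h is)"
  and mean_adjoint_box_op: "mean_adjoint (box_op h is) (box_op h is)"
  and local_avg_box_op: "local_avg (2 * real (length is) * \<bar>h\<bar>) (box_op h is)"
proof (induction "is")
  case (Cons i "is")
  show "avg_op (box_op h (i # is))"
    unfolding box_op.simps by (rule avg_op.comp[OF avg_op_seg2_op Cons(1)])
  show "mean_adjoint (box_op h (i # is)) (box_op h (i # is))"
    unfolding box_op.simps by (rule mean_adjoint_comp_self[OF mean_adjoint_seg2_op Cons(2) avg_op_seg2_op Cons(1)])
  show "local_avg (2 * real (length (i # is)) * \<bar>h\<bar>) (box_op h (i # is))"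
    using local_avg_comp[OF local_avg_seg2_op Cons(3) Cons(1), of h i] by (simp add: algebra_simps)
qed (simp_all add: avg_op_ident mean_adjoint_ident local_avg_ident)

lemma avg_op_lap_op: "avg_op (lap_op h is)"
  and mean_adjoint_lap_op: "mean_adjoint (lap_op h is) (lap_op h is)"
proof (induction "is")
  case Nil
  show "avg_op (lap_op h [])" by (simp add: avg_op_zero)
  show "mean_adjoint (lap_op h []) (lap_op h [])" by (simp add: mean_adjoint_def)
next
  case (Cons i "is")
  note a = avg_op.comp[OF avg_op_seg2_op Cons(1)] avg_op.comp[OF avg_op_diff2_op avg_op_box_op]
  note s = mean_adjoint_comp_self[OF mean_adjoint_seg2_op Cons(2) avg_op_seg2_op Cons(1)]
    mean_adjoint_comp_self[OF mean_adjoint_diff2_op mean_adjoint_box_op avg_op_diff2_op avg_op_box_op]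
  show "avg_op (lap_op h (i # is))"
    unfolding lap_op.simps by (rule avg_op.add[OF a])
  show "mean_adjoint (lap_op h (i # is)) (lap_op h (i # is))"
    unfolding lap_op.simps by (rule mean_adjoint_add[OF s a a])
qed

text \<open>The second difference is commuted inside the averages, replaced there by an averaged
  second derivative, and this new average is commuted out again to complete the box.\<close>

lemma lap_op_eq_box_op:
  fixes f :: "real ^ 'd \<Rightarrow> real"
  assumes "C_class 2 f" "h \<noteq> 0"
  shows "lap_op h is f = box_op h is (\<lambda>x. \<Sum>i\<leftarrow>is. partial_derivative i (partial_derivative i f) x)"
proof (induction "is")
  case (Cons i "is")
  let ?d = "\<lambda>i. partial_derivative i (partial_derivative i f)"
  have c: "continuous_on UNIV f" "\<And>i. continuous_on UNIV (?d i)"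
    using assms(1) by (simp_all add: numeral_2_eq_2)
  have cs: "continuous_on UNIV (\<lambda>x. \<Sum>i\<leftarrow>is. ?d i x)" for "is"
    by (induction "is") (auto intro!: continuous_on_add c)
  have "diff2_op h i (box_op h is f) = box_op h is (diff2_op h i f)"
    by (rule avg_op_commute[OF avg_op_box_op avg_op_diff2_op c(1)])
  also have "\<dots> = box_op h is (seg2_op h i (?d i))"
    by (simp only: seg2_op_second_partial[OF assms])
  also have "\<dots> = seg2_op h i (box_op h is (?d i))"
    by (rule avg_op_commute[OF avg_op_seg2_op avg_op_box_op c(2)])
  finally have 1: "diff2_op h i (box_op h is f) = seg2_op h i (box_op h is (?d i))" .
  have "box_op h (i # is) (\<lambda>x. ?d i x + (\<Sum>i\<leftarrow>is. ?d i x)) =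
      (\<lambda>x. box_op h (i # is) (?d i) x + box_op h (i # is) (\<lambda>x. \<Sum>i\<leftarrow>is. ?d i x) x)"
    by (rule avg_op_add[OF avg_op_box_op c(2) cs])
  then show ?case by (simp add: Cons 1 add.commute)
next
  case Nil
  then show ?case by simp
qed

definition factor_op :: "real \<Rightarrow> 'd list \<Rightarrow> real \<Rightarrow> (real ^ 'd \<Rightarrow> real) \<Rightarrow> real ^ 'd \<Rightarrow> real" where
  "factor_op h is c = (\<lambda>f x. lap_op h is f x + c * box_op h is f x)"

lemma avg_op_factor_op: "avg_op (factor_op h is c)"
  and mean_adjoint_factor_op: "mean_adjoint (factor_op h is c) (factor_op h is c)"
  unfolding factor_op_def
  by (rule avg_op.add[OF avg_op_lap_op avg_op.cmul[OF avg_op_box_op]],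
      rule mean_adjoint_add[OF mean_adjoint_lap_op mean_adjoint_cmul[OF mean_adjoint_box_op]
        avg_op_lap_op avg_op.cmul[OF avg_op_box_op] avg_op_lap_op avg_op.cmul[OF avg_op_box_op]])

lemma factor_op_eq_box_op:
  fixes f :: "real ^ 'd \<Rightarrow> real"
  assumes "C_class 2 f" "h \<noteq> 0" "distinct is" "set is = UNIV"
  shows "factor_op h is c f = box_op h is (\<lambda>x. laplacian f x + c * f x)"
proof -
  have c: "continuous_on UNIV f" using assms(1) by (rule C_class_continuous)
  have cl: "continuous_on UNIV (laplacian f)"
    by (rule C_class_continuous[OF C_class_laplacian[of 0]]) (use assms(1) in \<open>simp add: numeral_2_eq_2\<close>)
  have "(\<lambda>x. \<Sum>i\<leftarrow>is. partial_derivative i (partial_derivative i f) x) = laplacian f"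
    unfolding laplacian_def using assms(3,4) by (simp add: sum_list_distinct_conv_sum_set)
  then have "lap_op h is f = box_op h is (laplacian f)"
    using lap_op_eq_box_op[OF assms(1,2), of "is"] by simp
  moreover have "box_op h is (\<lambda>x. laplacian f x + c * f x) =
      (\<lambda>x. box_op h is (laplacian f) x + box_op h is (\<lambda>x. c * f x) x)"
    by (rule avg_op_add[OF avg_op_box_op cl continuous_on_mult[OF continuous_on_const c]])
  moreover have "box_op h is (\<lambda>x. c * f x) = (\<lambda>x. c * box_op h is f x)"
    by (rule avg_op_cmul[OF avg_op_box_op])
  ultimately show ?thesis unfolding factor_op_def by simp
qed

text \<open>Finite-difference counterpart of G: it acts on the bounded function \<open>f\<close>
  itself and never forms a derivative.\<close>

primrec G_avg :: "real \<Rightarrow> 'd list \<Rightarrow> (nat \<Rightarrow> real) \<Rightarrow> nat \<Rightarrow> (real ^ 'd \<Rightarrow> real) \<Rightarrow> real ^ 'd \<Rightarrow> real" where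
  "G_avg h is q 0 = (\<lambda>f. f)"
| "G_avg h is q (Suc m) = (\<lambda>f. factor_op h is ((q (Suc m))\<^sup>2) (G_avg h is q m f))"

lemma avg_op_G_avg: "avg_op (G_avg h is q m)"
  and mean_adjoint_G_avg: "mean_adjoint (G_avg h is q m) (G_avg h is q m)"
proof (induction m)
  case (Suc m)
  show "avg_op (G_avg h is q (Suc m))"
    unfolding G_avg.simps by (rule avg_op.comp[OF avg_op_factor_op Suc(1)])
  show "mean_adjoint (G_avg h is q (Suc m)) (G_avg h is q (Suc m))"
    unfolding G_avg.simps by (rule mean_adjoint_comp_self[OF mean_adjoint_factor_op Suc(2) avg_op_factor_op Suc(1)])
qed (simp_all add: avg_op_ident mean_adjoint_ident)

text \<open>Each factor contributes one box average. Commuted outwards, all \<open>m\<close> of them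
  act on \<open>G_op q m f\<close>.\<close>

lemma G_avg_eq:
  fixes f :: "real ^ 'd \<Rightarrow> real"
  assumes "h \<noteq> 0" "distinct is" "set is = UNIV"
  shows "C_class (2 * m) f \<Longrightarrow> G_avg h is q m f = (box_op h is ^^ m) (G_op q m f)"
proof (induction m)
  case (Suc m)
  let ?g = "G_op q m f" and ?c = "(q (Suc m))\<^sup>2"
  have C: "C_class (2 * m + 2) f" using Suc.prems by simp
  have g: "C_class 2 ?g" by (rule C_class_G_op[OF C])
  have "G_avg h is q (Suc m) f = factor_op h is ?c ((box_op h is ^^ m) ?g)"
    using Suc.IH[OF C_class_mono[OF C]] by simp
  also have "\<dots> = (box_op h is ^^ m) (factor_op h is ?c ?g)"
    by (rule avg_op_commute[OF avg_op_funpow[OF avg_op_box_op] avg_op_factor_op C_class_continuous[OF g]])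
  also have "\<dots> = (box_op h is ^^ m) (box_op h is (\<lambda>x. laplacian ?g x + ?c * ?g x))"
    by (simp only: factor_op_eq_box_op[OF g assms])
  also have "\<dots> = (box_op h is ^^ Suc m) (G_op q (Suc m) f)"
    by (simp add: funpow_swap1)
  finally show ?case .
qed simp

section \<open>Removing the averages by letting h tend to 0\<close>

lemma cube_mean_mult_diff_bound:
  fixes f g u :: "real ^ 'd \<Rightarrow> real"
  assumes "continuous_on UNIV f" "continuous_on UNIV g" "continuous_on UNIV u"
    "\<And>x. \<bar>f x - g x\<bar> \<le> e" "\<And>x. \<bar>u x\<bar> \<le> B" "\<rho> > 0"
  shows "\<bar>cube_mean \<rho> (\<lambda>x. f x * u x) - cube_mean \<rho> (\<lambda>x. g x * u x)\<bar> \<le> e * B"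
proof -
  have "cube_mean \<rho> (\<lambda>x. f x * u x) - cube_mean \<rho> (\<lambda>x. g x * u x) =
      cube_mean \<rho> (\<lambda>x. f x * u x - g x * u x)"
    by (rule cube_mean_diff[symmetric]) (intro continuous_on_mult assms)+
  also have "\<bar>\<dots>\<bar> \<le> e * B"
  proof (rule cube_mean_bound)
    show "continuous_on UNIV (\<lambda>x. f x * u x - g x * u x)"
      by (intro continuous_on_diff continuous_on_mult assms)
    fix x
    have "\<bar>f x - g x\<bar> * \<bar>u x\<bar> \<le> e * B"
      by (rule mult_mono[OF assms(4,5) order_trans[OF abs_ge_zero assms(4)] abs_ge_zero])
    then show "\<bar>f x * u x - g x * u x\<bar> \<le> e * B"
      by (simp add: abs_mult[symmetric] left_diff_distrib)
  qed (rule assms)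
  finally show ?thesis .
qed

text \<open>\<open>G_avg\<close> is symmetric in the mean for each fixed \<open>h\<close>. For small
  \<open>h\<close> the local averages of \<open>G_op q m a\<close> and \<open>G_op q m b\<close> are
  uniformly close to these functions, so removing them costs an amount independent of
  \<open>\<rho>\<close>.\<close>

lemma G_op_symmetric:
  fixes a b :: "real ^ 'd \<Rightarrow> real"
  assumes "C_class (2 * m) a" "C_class (2 * m) b"
    and ap: "bochner_ap a" "bochner_ap b" "bochner_ap (G_op q m a)" "bochner_ap (G_op q m b)"
  shows "((\<lambda>\<rho>. cube_mean \<rho> (\<lambda>x. G_op q m a x * b x) - cube_mean \<rho> (\<lambda>x. a x * G_op q m b x)) \<longlongrightarrow> 0) at_top"
proof (rule tendstoI)
  fix \<epsilon> :: real assume \<epsilon>: "\<epsilon> > 0"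
  obtain A where A: "A > 0" "\<And>x. \<bar>a x\<bar> \<le> A" using bochner_ap_bounded[OF ap(1)] by metis
  obtain B where B: "B > 0" "\<And>x. \<bar>b x\<bar> \<le> B" using bochner_ap_bounded[OF ap(2)] by metis
  \<comment> \<open>Removing the two averages costs \<open>e * B\<close> and \<open>e * A\<close>,
    together a third of \<open>\<epsilon>\<close>; the adjoint relation costs less than another
    third.\<close>
  define e where "e = \<epsilon> / 3 / (A + B)"
  have AB: "A + B > 0" using A(1) B(1) by simp
  then have "e > 0" using \<epsilon> by (simp add: e_def)
  have "e * (A + B) = \<epsilon> / 3" using AB e_def by (metis less_irrefl nonzero_eq_divide_eq)
  then have e3: "e * B + e * A = \<epsilon> / 3" by (simp add: distrib_left)
  obtain r1 where r1: "r1 > 0" "\<And>x z. norm z \<le> r1 \<Longrightarrow> \<bar>G_op q m a (x + z) - G_op q m a x\<bar> \<le> e"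
    using bochner_ap_uniformly_continuous[OF ap(3) \<open>e > 0\<close>] by metis
  obtain r2 where r2: "r2 > 0" "\<And>x z. norm z \<le> r2 \<Longrightarrow> \<bar>G_op q m b (x + z) - G_op q m b x\<bar> \<le> e"
    using bochner_ap_uniformly_continuous[OF ap(4) \<open>e > 0\<close>] by metis
  obtain "is" :: "'d list" where "is": "distinct is" "set is = UNIV"
    using finite_distinct_list[of "UNIV :: 'd set"] by auto
  \<comment> \<open>\<open>K * h\<close> is the reach of the iterated average: \<open>2 * h\<close>
    per direction, all directions, \<open>m\<close> times. Dividing by \<open>K + 1\<close> below
    keeps \<open>h\<close> defined even when \<open>K\<close> is zero.\<close>
  define K where "K = real m * (2 * real (length is))"
  have K: "K \<ge> 0" by (simp add: K_def)
  define h where "h = min r1 r2 / (K + 1)"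
  have h: "h > 0" using r1 r2 K by (simp add: h_def)
  have "K * h \<le> (K + 1) * h" using h by simp
  also have "\<dots> = min r1 r2" using K by (simp add: h_def)
  finally have Kh: "K * h \<le> r1" "K * h \<le> r2" by simp_all
  let ?T = "box_op h is ^^ m"
  have T: "avg_op ?T" by (rule avg_op_funpow[OF avg_op_box_op])
  have loc: "local_avg (K * h) ?T"
    using local_avg_funpow[OF local_avg_box_op[of "is" h] avg_op_box_op, of m] h by (simp add: K_def mult.assoc)
  note c = ap[THEN bochner_ap_continuous]
  have near_a: "\<bar>?T (G_op q m a) x - G_op q m a x\<bar> \<le> e" for x
    by (rule local_avgD[OF loc c(3)]) (use r1(2) Kh in auto)
  have near_b: "\<bar>?T (G_op q m b) x - G_op q m b x\<bar> \<le> e" for x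
    by (rule local_avgD[OF loc c(4)]) (use r2(2) Kh in auto)
  note cT = c(3,4)[THEN avg_op_continuous[OF T]]
  have bc: "bounded_cont a" "bounded_cont b"
    using A(2) B(2) c unfolding bounded_cont_def by blast+
  have eq: "G_avg h is q m a = ?T (G_op q m a)" "G_avg h is q m b = ?T (G_op q m b)"
    using G_avg_eq[OF _ "is"] h assms(1,2) by simp_all
  have "\<forall>\<^sub>F \<rho> in at_top. dist (cube_mean \<rho> (\<lambda>x. ?T (G_op q m a) x * b x) -
      cube_mean \<rho> (\<lambda>x. a x * ?T (G_op q m b) x)) 0 < \<epsilon> / 3"
    using tendstoD[OF mean_adjointD[OF mean_adjoint_G_avg[of h "is" q m] bc], of "\<epsilon> / 3"] \<epsilon> unfolding eq by simp
  moreover have "\<forall>\<^sub>F \<rho> :: real in at_top. \<rho> > 0" by (rule eventually_gt_at_top)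
  ultimately show "\<forall>\<^sub>F \<rho> in at_top. dist (cube_mean \<rho> (\<lambda>x. G_op q m a x * b x) -
      cube_mean \<rho> (\<lambda>x. a x * G_op q m b x)) 0 < \<epsilon>"
  proof eventually_elim
    case (elim \<rho>)
    have 1: "\<bar>cube_mean \<rho> (\<lambda>x. ?T (G_op q m a) x * b x) - cube_mean \<rho> (\<lambda>x. G_op q m a x * b x)\<bar> \<le> e * B"
      by (rule cube_mean_mult_diff_bound[OF cT(1) c(3) c(2) near_a B(2) elim(2)])
    have 2: "\<bar>cube_mean \<rho> (\<lambda>x. a x * ?T (G_op q m b) x) - cube_mean \<rho> (\<lambda>x. a x * G_op q m b x)\<bar> \<le> e * A"
      using cube_mean_mult_diff_bound[OF cT(2) c(4) c(1) near_b A(2) elim(2)] by (simp add: mult.commute)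
    show ?case using 1 2 elim(1) e3 \<epsilon> unfolding dist_real_def diff_0_right by linarith
  qed
qed

lemma ap_inner_G_op_symmetric:
  fixes a b :: "real ^ 'd \<Rightarrow> real"
  assumes "C_class (2 * m) a" "C_class (2 * m) b"
    and ap: "bochner_ap a" "bochner_ap b" "bochner_ap (G_op q m a)" "bochner_ap (G_op q m b)"
  shows "ap_inner (G_op q m a) b = ap_inner a (G_op q m b)"
proof -
  have "((\<lambda>\<rho>. cube_mean \<rho> (\<lambda>x. G_op q m a x * b x) - cube_mean \<rho> (\<lambda>x. a x * G_op q m b x))
      \<longlongrightarrow> ap_inner (G_op q m a) b - ap_inner a (G_op q m b)) at_top"
    by (intro tendsto_diff ap_inner_tendsto ap)
  from tendsto_unique[OF _ this G_op_symmetric[OF assms]] show ?thesis by simp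
qed

section \<open>The energy identity\<close>

lemma ap_inner_commute: "ap_inner f g = ap_inner g f"
  unfolding ap_inner_def by (simp add: mult.commute)

lemma ap_norm_square: "bochner_ap f \<Longrightarrow> (ap_norm f)\<^sup>2 = ap_inner f f"
  by (simp add: ap_norm_def ap_inner_self_nonneg)

lemma bochner_ap_N_pot': "bochner_ap f \<Longrightarrow> bochner_ap (\<lambda>x. N_pot' \<epsilon> \<alpha> (f x))"
  unfolding N_pot'_def by (intro bochner_ap_add bochner_ap_diff bochner_ap_cmul bochner_ap_power)

theorem theorem3p1:
  fixes m N\<^sub>T :: nat
    and q :: "nat \<Rightarrow> real"
    and \<epsilon> \<alpha> C\<^sub>1 T :: real
    and t \<tau> :: "nat \<Rightarrow> real"
    and \<phi> W :: "nat \<Rightarrow> real ^ 'd \<Rightarrow> real"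
    and R :: "nat \<Rightarrow> real"
  assumes dim: "CARD('d) \<in> {1, 2, 3}"
    and m: "m \<ge> 1"
    and C1: "C\<^sub>1 > 0"
    and F1_nonneg: "\<And>\<psi> :: real ^ 'd \<Rightarrow> real. almost_periodic \<psi> \<Longrightarrow> F1 \<epsilon> \<alpha> C\<^sub>1 \<psi> \<ge> 0"
    and partition: "t 0 = 0" "t N\<^sub>T = T" "\<And>n. n < N\<^sub>T \<Longrightarrow> t n < t (n + 1)"
    and step_size: "\<And>n. n < N\<^sub>T \<Longrightarrow> \<tau> n = t (n + 1) - t n"
    and ap: "\<And>n. n \<le> N\<^sub>T \<Longrightarrow> almost_periodic (\<phi> n)"
    and smooth: "\<And>n. n \<le> N\<^sub>T \<Longrightarrow> C_class (4 * m) (\<phi> n)"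
    and ap_G: "\<And>n. n \<le> N\<^sub>T \<Longrightarrow> almost_periodic (G_op q m (\<phi> n))"
    and scheme_phi: "\<And>n r. 1 \<le> n \<Longrightarrow> n < N\<^sub>T \<Longrightarrow>
          (\<phi> (n + 1) r - \<phi> n r) / \<tau> n = - W n r"
    and scheme_W: "\<And>n r. 1 \<le> n \<Longrightarrow> n < N\<^sub>T \<Longrightarrow>
          W n r = G_op q m (G_op q m (half_fun \<phi> n)) r
            + half_scalar R n / sqrt (F1 \<epsilon> \<alpha> C\<^sub>1 (extrap_fun \<phi> n)) * N_pot' \<epsilon> \<alpha> (extrap_fun \<phi> n r)"
    and scheme_R: "\<And>n. 1 \<le> n \<Longrightarrow> n < N\<^sub>T \<Longrightarrow>
          (R (n + 1) - R n) / \<tau> n =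
            ap_inner (\<lambda>r. N_pot' \<epsilon> \<alpha> (extrap_fun \<phi> n r) / (2 * sqrt (F1 \<epsilon> \<alpha> C\<^sub>1 (extrap_fun \<phi> n))))
                     (\<lambda>r. (\<phi> (n + 1) r - \<phi> n r) / \<tau> n)"
  shows "\<forall>n. 1 \<le> n \<and> n < N\<^sub>T \<longrightarrow>
           SAV_energy q m C\<^sub>1 \<phi> R (n + 1) - SAV_energy q m C\<^sub>1 \<phi> R n \<le> 0"
proof (intro allI impI)
  fix n assume n: "1 \<le> n \<and> n < N\<^sub>T"
  define u v e where "u = \<phi> (n + 1)" and "v = \<phi> n" and "e = extrap_fun \<phi> n"
  define s where "s = sqrt (F1 \<epsilon> \<alpha> C\<^sub>1 e)"
  \<comment> \<open>\<open>s\<close> may be zero. Then \<open>\<kappa>\<close> and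
    \<open>1 / (2 * s)\<close> are both zero by the convention for division, and the cancellation
    below remains valid.\<close>
  define \<kappa> where "\<kappa> = half_scalar R n / s"
  define N where "N r = N_pot' \<epsilon> \<alpha> (e r)" for r
  \<comment> \<open>The increment and the midpoint are spelled as two-term combinations so that the
    linearity lemmas apply verbatim.\<close>
  define \<delta> where "\<delta> r = 1 * u r + - 1 * v r" for r
  define w where "w r = 1 / 2 * u r + 1 / 2 * v r" for r
  have half: "half_fun \<phi> n = w"
    by (auto simp: half_fun_def w_def u_def v_def)
  have \<tau>: "\<tau> n > 0" using partition(3)[of n] step_size[of n] n by simp
  have ap_u: "bochner_ap u" and ap_v: "bochner_ap v"
    using n by (auto simp: u_def v_def intro!: almost_periodic_imp_bochner_ap ap)
  have ap_e: "bochner_ap e"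
  proof -
    have "e = (\<lambda>r. 3 / 2 * \<phi> n r - 1 / 2 * \<phi> (n - 1) r)"
      by (auto simp: e_def extrap_fun_def)
    moreover have "bochner_ap (\<lambda>r. 3 / 2 * \<phi> n r - 1 / 2 * \<phi> (n - 1) r)"
      by (intro bochner_ap_diff bochner_ap_cmul almost_periodic_imp_bochner_ap ap) (use n in auto)
    ultimately show ?thesis by simp
  qed
  have ap_Gu: "bochner_ap (G_op q m u)" and ap_Gv: "bochner_ap (G_op q m v)"
    using n by (auto simp: u_def v_def intro!: almost_periodic_imp_bochner_ap ap_G)
  have ap_N: "bochner_ap N" unfolding N_def[abs_def] by (rule bochner_ap_N_pot'[OF ap_e])
  have ap_\<delta>: "bochner_ap \<delta>" unfolding \<delta>_def[abs_def]
    by (intro bochner_ap_add bochner_ap_cmul ap_u ap_v)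
  \<comment> \<open>Half of the \<open>4 * m\<close> orders is spent on the first application of G,
    the other half remains for the second.\<close>
  have "C_class (2 * m + 2 * m) u" "C_class (2 * m + 2 * m) v"
    using smooth[of "n + 1"] smooth[of n] n by (simp_all add: u_def v_def)
  note C4 = this and C2 = this[THEN C_class_mono]
  have C2_\<delta>: "C_class (2 * m) \<delta>" unfolding \<delta>_def[abs_def] by (intro C_class_combination C2)
  have C2_Gw: "C_class (2 * m) (G_op q m w)"
    by (rule C_class_G_op) (unfold w_def[abs_def], intro C_class_combination C4)
  have G\<delta>: "G_op q m \<delta> = (\<lambda>r. 1 * G_op q m u r + - 1 * G_op q m v r)"
    unfolding \<delta>_def[abs_def] by (rule G_op_combination[OF C2])
  have Gw: "G_op q m w = (\<lambda>r. 1 / 2 * G_op q m u r + 1 / 2 * G_op q m v r)"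
    unfolding w_def[abs_def] by (rule G_op_combination[OF C2])
  have ap_G\<delta>: "bochner_ap (G_op q m \<delta>)" and ap_Gw: "bochner_ap (G_op q m w)"
    unfolding G\<delta> Gw by (intro bochner_ap_add bochner_ap_cmul ap_Gu ap_Gv)+
  \<comment> \<open>Solved for its highest-order term, the scheme equation also supplies the almost
    periodicity of that term, which symmetry for \<open>\<delta>\<close> and
    \<open>G_op q m w\<close> requires.\<close>
  have GGw: "G_op q m (G_op q m w) = (\<lambda>r. - 1 / \<tau> n * \<delta> r + - \<kappa> * N r)"
  proof
    fix r
    have "\<delta> r / \<tau> n = - W n r"
      using scheme_phi[of n r] n by (simp add: \<delta>_def u_def v_def)
    moreover have "W n r = G_op q m (G_op q m w) r + \<kappa> * N r"
      using scheme_W[of n r] n by (simp add: half \<kappa>_def s_def e_def N_def)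
    ultimately show "G_op q m (G_op q m w) r = - 1 / \<tau> n * \<delta> r + - \<kappa> * N r" by simp
  qed
  have ap_GGw: "bochner_ap (G_op q m (G_op q m w))"
    unfolding GGw by (intro bochner_ap_add bochner_ap_cmul ap_\<delta> ap_N)
  let ?I = "ap_inner N \<delta>"
  \<comment> \<open>Difference of squares: the increment paired with the midpoint; the mixed terms
    cancel by symmetry of the inner product.\<close>
  have "ap_inner (G_op q m \<delta>) (G_op q m w) =
      1 / 2 * ap_inner (G_op q m u) (G_op q m u) - 1 / 2 * ap_inner (G_op q m v) (G_op q m v)"
  proof -
    have "ap_inner (G_op q m \<delta>) (G_op q m w) =
        1 / 2 * ap_inner (G_op q m \<delta>) (G_op q m u) + 1 / 2 * ap_inner (G_op q m \<delta>) (G_op q m v)"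
      unfolding Gw by (rule ap_inner_combination[OF ap_G\<delta> ap_Gu ap_Gv])
    moreover have "ap_inner (G_op q m \<delta>) k = 1 * ap_inner k (G_op q m u) + - 1 * ap_inner k (G_op q m v)"
      if "bochner_ap k" for k
      unfolding ap_inner_commute[of _ k] G\<delta> by (rule ap_inner_combination[OF that ap_Gu ap_Gv])
    ultimately show ?thesis
      using ap_Gu ap_Gv by (simp add: ap_inner_commute[of "G_op q m v" "G_op q m u"] algebra_simps)
  qed
  moreover have "ap_inner (G_op q m \<delta>) (G_op q m w) = - 1 / \<tau> n * ap_inner \<delta> \<delta> + - \<kappa> * ?I"
    unfolding ap_inner_G_op_symmetric[OF C2_\<delta> C2_Gw ap_\<delta> ap_Gw ap_G\<delta> ap_GGw]
    unfolding GGw ap_inner_commute[of N \<delta>] by (rule ap_inner_combination[OF ap_\<delta> ap_\<delta> ap_N])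
  moreover have "(R (n + 1))\<^sup>2 - (R n)\<^sup>2 = \<kappa> * ?I"
  proof -
    \<comment> \<open>The vanishing second terms bring the scalar multiples into the form of
      \<open>ap_inner_combination\<close>.\<close>
    have "(R (n + 1) - R n) / \<tau> n = ap_inner (\<lambda>r. 1 / (2 * s) * N r + 0 * N r) (\<lambda>r. 1 / \<tau> n * \<delta> r + 0 * \<delta> r)"
      using scheme_R[of n] n by (simp add: s_def e_def N_def \<delta>_def u_def v_def)
    also have "\<dots> = 1 / \<tau> n * ap_inner (\<lambda>r. 1 / (2 * s) * N r + 0 * N r) \<delta> +
        0 * ap_inner (\<lambda>r. 1 / (2 * s) * N r + 0 * N r) \<delta>"
      by (rule ap_inner_combination[OF _ ap_\<delta> ap_\<delta>]) (intro bochner_ap_add bochner_ap_cmul ap_N)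
    also have "ap_inner (\<lambda>r. 1 / (2 * s) * N r + 0 * N r) \<delta> = 1 / (2 * s) * ?I + 0 * ?I"
      unfolding ap_inner_commute[of _ \<delta>] by (rule ap_inner_combination[OF ap_\<delta> ap_N ap_N])
    finally have "R (n + 1) - R n = 1 / (2 * s) * ?I" using \<tau> by (simp add: field_simps)
    then have "(R (n + 1))\<^sup>2 - (R n)\<^sup>2 = 2 * half_scalar R n * (1 / (2 * s) * ?I)"
      by (simp add: half_scalar_def power2_eq_square algebra_simps)
    then show ?thesis by (simp add: \<kappa>_def)
  qed
  ultimately have "SAV_energy q m C\<^sub>1 \<phi> R (n + 1) - SAV_energy q m C\<^sub>1 \<phi> R n = - (ap_inner \<delta> \<delta> / \<tau> n)"
    using ap_norm_square[OF ap_Gu] ap_norm_square[OF ap_Gv]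
    by (simp add: SAV_energy_def u_def v_def)
  then show "SAV_energy q m C\<^sub>1 \<phi> R (n + 1) - SAV_energy q m C\<^sub>1 \<phi> R n \<le> 0"
    using ap_inner_self_nonneg[OF ap_\<delta>] \<tau> by simp
qed

end
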